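(* Let $k\geq2$ be an integer. Then, as $n\to\infty$ over the positive integers, \[\frac{n^{k-1/2}}{2^{2-3/(k+1)}(k+1)!}-O(n^{k-1})\leq\mathrm{ex}(n,K^k_{k+1},\mathcal{S}^kC_4)\leq\frac{n^{k-1/2}}{(k+1)!}+O(n^{k-1}),\] where the implied constants may depend only on $k$.
   Context: For an integer $k\geq2$ and a graph $F$, the $k$-uniform suspension $\mathcal{S}^kF$ is the $k$-uniform hypergraph with vertex set $S\cup V(F)$ and edge set $\{S\cup e:\,e\in E(F)\}$, where $S$ is a set of size $k-2$ disjoint from $V(F)$. $C_4$ is the cycle of length $4$. $K^k_t$ is the $k$-uniform clique of order $t$, i.e. the hypergraph on $t$ vertices whose edges are all $k$-element subsets. A $k$-uniform hypergraph is $H$-free if it contains no (not necessarily induced) subhypergraph isomorphic to $H$; a copy of $T$ is a subhypergraph isomorphic to $T$. For $k$-uniform hypergraphs $T$ and $H$, $\mathrm{ex}(n,T,H)$ is the maximum number of copies of $T$ in an $n$-vertex $H$-free $k$-uniform hypergraph. *)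

theory Defs
  imports Complex_Main "HOL-Library.Landau_Symbols"
begin

datatype 'a hypergraph = Hypergraph (verts: "'a set") (edges: "'a set set")

definition hypergraph :: "'a hypergraph \<Rightarrow> bool" where
  "hypergraph G \<longleftrightarrow> finite (verts G) \<and> (\<forall>e\<in>edges G. e \<subseteq> verts G)"

definition uniform :: "nat \<Rightarrow> 'a hypergraph \<Rightarrow> bool" where
  "uniform k G \<longleftrightarrow> hypergraph G \<and> (\<forall>e\<in>edges G. card e = k)"

definition subhypergraph :: "'a hypergraph \<Rightarrow> 'a hypergraph \<Rightarrow> bool" where
  "subhypergraph S G \<longleftrightarrow> hypergraph S \<and> verts S \<subseteq> verts G \<and> edges S \<subseteq> edges G"

definition isomorphic :: "'a hypergraph \<Rightarrow> 'b hypergraph \<Rightarrow> bool" where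
  "isomorphic G H \<longleftrightarrow>
     (\<exists>f. bij_betw f (verts G) (verts H) \<and> edges H = (\<lambda>e. f ` e) ` edges G)"

definition copies :: "'b hypergraph \<Rightarrow> 'a hypergraph \<Rightarrow> 'a hypergraph set" where
  "copies T G = {S. subhypergraph S G \<and> isomorphic T S}"

definition free_of :: "'b hypergraph \<Rightarrow> 'a hypergraph \<Rightarrow> bool" where
  "free_of H G \<longleftrightarrow> copies H G = {}"

(* Every finite hypergraph is isomorphic to one whose vertices are natural numbers, so
   ranging over nat hypergraphs loses nothing. For fixed n the set below is finite (an
   n-vertex hypergraph has boundedly many subhypergraphs), and it is nonempty whenever H
   has an edge, so Max is then a genuine maximum. *)
definition ex :: "nat \<Rightarrow> nat \<Rightarrow> 'a hypergraph \<Rightarrow> 'b hypergraph \<Rightarrow> nat" where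
  "ex k n T H =
     Max {card (copies T G) | G :: nat hypergraph.
            uniform k G \<and> card (verts G) = n \<and> free_of H G}"

definition clique :: "nat \<Rightarrow> nat \<Rightarrow> nat hypergraph" where
  "clique k t = Hypergraph {..<t} {e. e \<subseteq> {..<t} \<and> card e = k}"

(* Meaningful as a cycle for m \<ge> 3. *)
definition cycle :: "nat \<Rightarrow> nat hypergraph" where
  "cycle m = Hypergraph {..<m} ((\<lambda>i. {i, Suc i mod m}) ` {..<m})"

(* The sum type makes the added vertices Inl ` {..<k-2} disjoint from V(F). *)
definition suspension :: "nat \<Rightarrow> 'a hypergraph \<Rightarrow> (nat + 'a) hypergraph" where
  "suspension k F =
     Hypergraph (Inl ` {..<k-2} \<union> Inr ` verts F) ((\<lambda>e. Inl ` {..<k-2} \<union> Inr ` e) ` edges F)"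

end

(* Upper bound: in a suspension-of-C4-free k-graph two cliques of order k + 1 never share an edge,
   so (k + 1) #cliques <= #edges, and the link graph of every (k - 2)-set is C4-free, which bounds
   #edges by Cauchy-Schwarz.

   Lower bound: let K be a field with q = 2^m elements, Q(a, b) = a b on K^2 and B its polar form.
   Take as cliques all (k + 1)-sets T in general position with sum 0 and with Q summing to 1, and as
   edges the sets T - {x}. An edge e satisfies phi(e) = sum Q(e) + Q(sum e) = 1, and in
   characteristic 2 the condition phi(S + x + y) = 1 reads B(x + s, y + s) = 1 + phi(S), where
   s = sum S. For fixed x this is a line in y, and distinct x give distinct lines as soon as
   phi(S) <> 1; the latter holds because phi(S) = 1 + phi(T - S) and the three points of T - S are not
   collinear. So all links are C4-free, and there are about q^(2k-1) / (k + 1)! cliques.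
   Restricting the vertices to K x L with L an additive subgroup of index 2 gives a second
   construction on q^2 / 2 vertices. For arbitrary n one either adds isolated vertices or passes to an
   average n-subset of a larger construction; the worst n costs the factor 2^(2 - 3/(k + 1)). *)

theory Submission
  imports Defs "HOL-Algebra.Algebraic_Closure_Type" "HOL-Library.Z2" "HOL-Library.Product_Plus"
begin

section \<open>Finite fields of characteristic 2\<close>

text \<open>Sum 0 forces the last point of a clique: it is the sum of the other \<open>k\<close>, so
  every edge of the construction lies in exactly one of the chosen cliques and
  \<open>(k + 1) #cliques = #edges\<close> for them. In the link of a \<open>(k - 2)\<close>-set the
  neighbours of a point lie on a line with \<open>q\<close> points, the square root of the number of
  vertices of \<open>K^2\<close>. So both inequalities behind the upper bound can be tight to
  leading order at once. Characteristic 2 makes the polar form alternating and gives complementary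
  parts of a clique equal sums; this is how \<open>phi\<close> of a \<open>(k - 2)\<close>-set is
  controlled by a triple. The price is that the available orders are powers of 2, which is the
  source of the extra factor in the lower bound. The obstacle in the count is that a clique must
  satisfy two equations, be in general position and stay inside \<open>K x L\<close>. Therefore
  \<open>k - 1\<close> points are chosen greedily under conditions on all their subsets, strong
  enough that one more point can run over almost all of a line and the last point is then
  determined. This gives about \<open>|V|^(k-1) |L|\<close> ordered cliques.\<close>

lemma card_roots_separable:
  fixes p :: "'a :: alg_closed_field poly"
  assumes "p \<noteq> 0" and sep: "\<And>x. poly p x = 0 \<Longrightarrow> poly (pderiv p) x \<noteq> 0"
  shows "card {x. poly p x = 0} = degree p"
proof -
  obtain A where A: "size A = degree p" "p = smult (lead_coeff p) (\<Prod>x\<in>#A. [:-x, 1:])"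
    using alg_closed_imp_factorization[OF assms(1)] by blast
  have roots: "{x. poly p x = 0} = set_mset A"
    by (subst A(2)) (use assms(1) in \<open>auto simp: poly_prod_mset prod_mset_zero_iff\<close>)
  \<comment> \<open>At a root of multiplicity at least 2 the square of the linear factor divides
    \<open>p\<close>, so \<open>p\<close> and \<open>pderiv p\<close> vanish together.\<close>
  have count: "count A x = 1" if "x \<in># A" for x
  proof (rule ccontr)
    assume "count A x \<noteq> 1"
    with that have "count A x \<ge> 2"
      using count_greater_zero_iff[of A x] by linarith
    then have "replicate_mset 2 x \<subseteq># A"
      by (metis count_le_replicate_mset_subset_eq)
    then obtain B where "A = replicate_mset 2 x + B"
      by (metis mset_subset_eq_exists_conv)
    then have "p = [:-x, 1:] ^ 2 * smult (lead_coeff p) (\<Prod>x\<in>#B. [:-x, 1:])"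
      by (subst A(2)) (simp only: prod_mset_Un image_mset_union image_replicate_mset prod_mset_replicate_mset mult_smult_right)
    then obtain r where r: "p = [:-x, 1:] ^ 2 * r"
      by blast
    have "poly p x = 0" "poly (pderiv p) x = 0"
      by (simp_all only: r power2_eq_square pderiv_mult poly_add poly_mult) simp_all
    with sep show False by blast
  qed
  have "card (set_mset A) = (\<Sum>x\<in>set_mset A. count A x)"
    using count by simp
  also have "\<dots> = size A"
    by (simp add: size_multiset_overloaded_eq)
  finally show ?thesis
    using A(1) roots by simp
qed

lemma CHAR_bit: "CHAR(bit) = 2"
proof (rule CHAR_eq_posI)
  show "of_nat 2 = (0 :: bit)"
    by (simp only: of_nat_numeral bit_2_eq_0)
  fix x :: nat
  assume "0 < x" "x < 2"
  then have "x = 1" by linarith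
  then show "of_nat x \<noteq> (0 :: bit)" 
    by (simp only: of_nat_1) (rule one_neq_zero)
qed (rule zero_less_numeral)

text \<open>The fixed points are the roots of \<open>X^(2^m) - X\<close>, whose derivative is the
  constant -1 in characteristic 2, so there is no repeated root.\<close>

lemma card_frobenius_fixpoints:
  assumes "CHAR('a :: alg_closed_field) = 2" and m: "m > 0"
  shows "card {x :: 'a. x ^ 2 ^ m = x} = 2 ^ m"
proof -
  define p :: "'a poly" where "p = monom 1 (2 ^ m) - monom 1 1"
  have "of_nat 2 = (0 :: 'a)"
    using assms(1) by (metis of_nat_CHAR)
  then have two: "of_nat (2 ^ m) = (0 :: 'a)"
    using m by (simp only: of_nat_power) (simp add: zero_power)
  have "(1 :: nat) < 2 ^ m"
    using m by (rule one_less_power[rotated]) simp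
  then have deg: "degree p = 2 ^ m"
    unfolding p_def by (subst diff_conv_add_uminus, subst degree_add_eq_left) (auto simp: degree_monom_eq)
  have "pderiv p = -1"
    unfolding p_def by (simp only: pderiv_diff pderiv_monom two) (simp add: monom_0 one_pCons)
  moreover have "p \<noteq> 0"
    using deg by force
  ultimately have "card {x. poly p x = 0} = degree p"
    by (intro card_roots_separable) simp_all
  moreover have "{x. poly p x = 0} = {x. x ^ 2 ^ m = x}"
    by (simp add: p_def poly_monom)
  ultimately show ?thesis
    using deg by simp
qed

text \<open>Every element is its own negative, so closure under addition already makes
  \<open>K\<close> a subfield and \<open>L\<close> an additive subgroup. The instances are
  \<open>L = K\<close> and \<open>L\<close> of index 2.\<close>

locale char2_plane =
  fixes K L :: "'a :: field set"
  assumes char2: "x + x = (0 :: 'a)"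
    and finite_K: "finite K"
    and one_K: "1 \<in> K"
    and add_K: "x \<in> K \<Longrightarrow> y \<in> K \<Longrightarrow> x + y \<in> K"
    and mult_K: "x \<in> K \<Longrightarrow> y \<in> K \<Longrightarrow> x * y \<in> K"
    and inverse_K: "x \<in> K \<Longrightarrow> inverse x \<in> K"
    and L_subset_K: "L \<subseteq> K"
    and zero_L: "0 \<in> L"
    and add_L: "x \<in> L \<Longrightarrow> y \<in> L \<Longrightarrow> x + y \<in> L"

text \<open>\<open>K\<close> is the field with \<open>2^m\<close> elements inside the algebraic
  closure of the two-element field. For \<open>j = 1\<close> the subgroup is the image of the
  Artin-Schreier map \<open>x * x + x\<close>, which is additive with kernel \<open>{0, 1}\<close>
  and hence two-to-one on \<open>K\<close>.\<close>

lemma char2_plane_exists: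
  assumes "m > 0" "j \<le> 1"
  shows "\<exists>K L :: bit alg_closure set. char2_plane K L \<and> card K = 2 ^ m \<and> card L = 2 ^ (m - j)"
proof -
  define K :: "bit alg_closure set" where "K = {x. x ^ 2 ^ m = x}"
  have char: "CHAR(bit alg_closure) = 2"
    by (simp add: CHAR_bit)
  have two: "of_nat 2 = (0 :: bit alg_closure)"
    using char by (metis of_nat_CHAR)
  have self: "x + x = 0" for x :: "bit alg_closure"
    using two by (metis mult_2 mult_zero_left of_nat_numeral)
  have frob: "(x + y) ^ 2 ^ i = x ^ 2 ^ i + y ^ 2 ^ i" for x y :: "bit alg_closure" and i
    using freshmans_dream'[where n = i and 'a = "bit alg_closure"] char by simp
  have card_K: "card K = 2 ^ m"
    unfolding K_def by (rule card_frobenius_fixpoints[OF char assms(1)])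
  have fin: "finite K"
    using card_K by (metis card.infinite power_not_zero zero_neq_numeral)
  have K: "0 \<in> K" "1 \<in> K" "\<And>x y. x \<in> K \<Longrightarrow> y \<in> K \<Longrightarrow> x + y \<in> K"
    "\<And>x y. x \<in> K \<Longrightarrow> y \<in> K \<Longrightarrow> x * y \<in> K" "\<And>x. x \<in> K \<Longrightarrow> inverse x \<in> K"
    unfolding K_def by (simp_all add: frob power_mult_distrib power_inverse)
  consider "j = 0" | "j = 1" using assms(2) by linarith
  then show ?thesis
  proof cases
    case 1
    have "char2_plane K K"
      by unfold_locales (use self fin K in auto)
    then show ?thesis using 1 card_K by auto
  next
    case 2
    define f :: "bit alg_closure \<Rightarrow> bit alg_closure" where "f = (\<lambda>x. x * x + x)"
    have f_add: "f (x + y) = f x + f y" for x y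
    proof -
      have "f (x + y) = f x + f y + (x * y + x * y)"
        by (simp add: f_def algebra_simps)
      then show ?thesis by (simp only: self add_0_right)
    qed
    have fK: "f x \<in> K" if "x \<in> K" for x
      using that K by (simp add: f_def)
    have "char2_plane K (f ` K)"
    proof unfold_locales
      show "0 \<in> f ` K"
        using K(1) by (auto simp: f_def intro!: image_eqI[of _ _ 0])
      show "x + y \<in> f ` K" if "x \<in> f ` K" "y \<in> f ` K" for x y
        using that K(3) by (auto simp flip: f_add)
    qed (use self fin K fK in auto)
    moreover have "card (f ` K) = 2 ^ (m - 1)"
    proof -
      have fibre: "card {x \<in> K. f x = y} = 2" if "y \<in> f ` K" for y
      proof -
        obtain a where a: "a \<in> K" "y = f a" using \<open>y \<in> f ` K\<close> by auto
        have "f x = f a \<longleftrightarrow> x = a \<or> x = a + 1" for x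
        proof -
          have "f x = f a \<longleftrightarrow> f x + f a = 0"
            by (metis self add_right_cancel)
          also have "f x + f a = (x + a) * (x + a + 1)"
            unfolding f_add[symmetric] by (simp add: f_def algebra_simps)
          also have "(x + a) * (x + a + 1) = 0 \<longleftrightarrow> x = a \<or> x = a + 1"
            using self[of a] self[of "a + 1"]
            by (simp only: mult_eq_0_iff add_eq_0_iff2 add.assoc) (metis self minus_unique)
          finally show ?thesis .
        qed
        then have "{x \<in> K. f x = y} = {a, a + 1}"
          using a K by auto
        then show ?thesis by simp
      qed
      have "card K = (\<Sum>y\<in>f ` K. card {x \<in> K. f x = y})"
        by (subst card_UN_disjoint[symmetric]) (use fin in \<open>auto intro: arg_cong[where f = card]\<close>)
      also have "\<dots> = 2 * card (f ` K)"
        using fibre by simp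
      finally have "2 * card (f ` K) = 2 * 2 ^ (m - 1)"
        using card_K assms(1) by (simp flip: power_Suc)
      then show ?thesis by simp
    qed
    ultimately show ?thesis using 2 card_K by auto
  qed
qed

section \<open>The hypergraph of a plane of characteristic 2\<close>

definition quad :: "'a \<times> 'a \<Rightarrow> 'a :: comm_semiring_1" where
  "quad x = fst x * snd x"

definition polar :: "'a \<times> 'a \<Rightarrow> 'a \<times> 'a \<Rightarrow> 'a :: comm_semiring_1" where
  "polar x y = fst x * snd y + snd x * fst y"

text \<open>In characteristic 2, \<open>phi A\<close> is the sum of \<open>polar x y\<close> over all pairs \<open>{x, y} \<subseteq> A\<close>; for a triple
  it vanishes exactly if the three points are collinear.\<close>

definition phi :: "('a \<times> 'a) set \<Rightarrow> 'a :: comm_semiring_1" where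
  "phi A = sum quad A + quad (\<Sum>A)"

text \<open>The copies of the suspended 4-cycle stated for bare edge sets; the link to
  \<open>free_of\<close> is \<open>free_of_suspension_C4_iff\<close>.\<close>

definition suspended_C4 :: "nat \<Rightarrow> 'b set set \<Rightarrow> bool" where
  "suspended_C4 k E \<longleftrightarrow> (\<exists>S x y z w. finite S \<and> card S = k - 2 \<and> distinct [x, y, z, w] \<and>
     S \<inter> {x, y, z, w} = {} \<and>
     S \<union> {x, y} \<in> E \<and> S \<union> {y, z} \<in> E \<and> S \<union> {z, w} \<in> E \<and> S \<union> {w, x} \<in> E)"

text \<open>The vertex sets of the cliques of order \<open>k + 1\<close>; they are matched with
  \<open>copies\<close> in \<open>card_copies_clique\<close>.\<close>

definition full_sets :: "nat \<Rightarrow> 'b set \<Rightarrow> 'b set set \<Rightarrow> 'b set set" where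
  "full_sets k V E = {T. T \<subseteq> V \<and> card T = k + 1 \<and> (\<forall>e \<subseteq> T. card e = k \<longrightarrow> e \<in> E)}"

context char2_plane
begin

section \<open>Identities for the quadratic form in characteristic 2\<close>

definition V :: "('a \<times> 'a) set" where "V = K \<times> L"

lemma add_self2: "x + (x + y) = (y :: 'a)"
  by (simp add: char2 flip: add.assoc)

lemma two_zero: "(2 :: 'a) = 0"
  using char2[of 1] by simp

lemma pair_char2: "x + x = (0 :: 'a \<times> 'a)"
  by (cases x) (simp add: char2 zero_prod_def)

lemma add_eq_0_iff_eq: "x + y = 0 \<longleftrightarrow> x = (y :: 'a)"
  by (metis char2 add_right_cancel)

lemmas char2_simps = char2 add_self2 two_zero

lemma phi_empty: "phi {} = (0 :: 'a)"
  by (simp add: phi_def quad_def)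

lemma phi_insert:
  assumes "finite A" "x \<notin> A"
  shows "phi (insert x A) = phi A + polar x (\<Sum>A :: 'a \<times> 'a)"
  using assms by (simp add: phi_def quad_def polar_def algebra_simps char2_simps)

text \<open>With \<open>s\<close> the sum of \<open>S\<close>, the form
  \<open>polar (x + s) (y + s)\<close> expands to \<open>polar x y\<close> plus
  \<open>polar x s\<close> plus \<open>polar y s\<close>, since \<open>polar s s\<close> vanishes.
  Translating by \<open>s\<close> thus absorbs the interaction of the pair with
  \<open>S\<close>.\<close>

lemma phi_insert2:
  assumes "finite S" "x \<notin> S" "y \<notin> S" "x \<noteq> y"
  shows "phi (S \<union> {x, y}) = phi S + polar (x + \<Sum>S) (y + \<Sum>S :: 'a \<times> 'a)"
proof -
  have "S \<union> {x, y} = insert x (insert y S)" by auto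
  then show ?thesis
    using assms by (simp add: phi_insert) (simp add: polar_def algebra_simps char2_simps)
qed

text \<open>Since the total is 0, \<open>S\<close> and \<open>T - S\<close> have the same sum, so
  the \<open>quad\<close> terms of the two sums agree and only the splitting of
  \<open>sum quad T\<close> remains.\<close>

lemma phi_compl:
  assumes "finite T" "S \<subseteq> T" "\<Sum>T = (0 :: 'a \<times> 'a)" "sum quad T = 1"
  shows "phi S = 1 + phi (T - S)"
proof -
  have "\<Sum>T = \<Sum>(T - S) + \<Sum>S"
    using sum.subset_diff[of S T "\<lambda>x. x"] assms by simp
  then have eq: "\<Sum>(T - S) = \<Sum>S"
    using assms(3) by (metis pair_char2 add_right_cancel)
  have "1 = sum quad (T - S) + sum quad S"
    using sum.subset_diff[of S T quad] assms by simp
  then have "sum quad S = 1 + sum quad (T - S)"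
    by (metis add.commute add_self2)
  then show ?thesis
    by (simp add: phi_def eq add.assoc)
qed

text \<open>Cramer's rule for the linear dependence of three vectors of a plane, one coordinate at a
  time; in characteristic 2 the signs disappear.\<close>

lemma polar_cramer:
  "polar u' v * fst u + polar u v * fst u' = polar u u' * fst v"
  "polar u' v * snd u + polar u v * snd u' = polar u u' * (snd v :: 'a)"
  by (simp_all add: polar_def algebra_simps char2_simps)

text \<open>By \<open>polar_cramer\<close>, \<open>d (u + u')\<close> equals both
  \<open>polar u u'\<close> times \<open>v\<close> and \<open>polar u u'\<close> times
  \<open>v'\<close>. As \<open>v\<close> and \<open>v'\<close> differ, \<open>polar u u'\<close> is
  0, and then \<open>d \<noteq> 0\<close> leaves \<open>u + u' = 0\<close>.\<close>

lemma polar_C4_free: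
  assumes "polar u v = d" "polar u v' = d" "polar u' v = d" "polar u' v' = d"
    and "d \<noteq> 0" "v \<noteq> v'"
  shows "u = (u' :: 'a \<times> 'a)"
proof -
  have *: "polar u u' * fst v = polar u u' * fst v'" "polar u u' * snd v = polar u u' * snd v'"
    using polar_cramer[of u' v u] polar_cramer[of u' v' u] assms(1-4) by simp_all
  then have "polar u u' = 0"
    using assms(6) by (auto simp: prod_eq_iff)
  then have "d * (fst u + fst u') = 0" "d * (snd u + snd u') = 0"
    using polar_cramer[of u' v u] assms by (simp_all add: distrib_left)
  then show ?thesis
    using assms(5) by (simp add: prod_eq_iff add_eq_0_iff_eq)
qed

definition blocks :: "nat \<Rightarrow> ('a \<times> 'a) set set" where
  "blocks k = {T. T \<subseteq> V \<and> card T = k + 1 \<and> \<Sum>T = 0 \<and> sum quad T = 1 \<and>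
     (\<forall>A \<subseteq> T. card A = 3 \<longrightarrow> phi A \<noteq> 0)}"

definition block_edges :: "nat \<Rightarrow> ('a \<times> 'a) set set" where
  "block_edges k = (\<Union>T \<in> blocks k. (\<lambda>x. T - {x}) ` T)"

lemma finite_V: "finite V"
  unfolding V_def using finite_K finite_subset[OF L_subset_K] by simp

text \<open>Both values of \<open>phi\<close> come from \<open>phi_compl\<close>: the complement of
  an edge in its block is a point, where \<open>phi\<close> is 0, and the complement of
  \<open>S\<close> is a triple, where general position makes \<open>phi\<close> nonzero.\<close>

lemma block_edgesD:
  assumes "e \<in> block_edges k" "k \<ge> 2"
  shows "e \<subseteq> V" "card e = k" "phi e = 1" "S \<subseteq> e \<Longrightarrow> card S = k - 2 \<Longrightarrow> phi S \<noteq> 1"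
proof -
  obtain T x where T: "T \<in> blocks k" "x \<in> T" "e = T - {x}"
    using assms unfolding block_edges_def by blast
  then have T': "T \<subseteq> V" "card T = k + 1" "\<Sum>T = 0" "sum quad T = 1"
    "\<And>A. A \<subseteq> T \<Longrightarrow> card A = 3 \<Longrightarrow> phi A \<noteq> 0"
    by (auto simp: blocks_def)
  have fin: "finite T" using T'(2) card.infinite by force
  show "e \<subseteq> V" "card e = k" using T T' fin by auto
  have "phi e = 1 + phi (T - e)"
    using T T' fin by (intro phi_compl) auto
  also have "T - e = {x}" using T by auto
  also have "phi {x} = 0" by (simp add: phi_def char2)
  finally show "phi e = 1" by simp
  assume S: "S \<subseteq> e" "card S = k - 2"
  then have "S \<subseteq> T" using T by auto
  have "card (T - S) = 3"
    using S T'(2) \<open>S \<subseteq> T\<close> fin \<open>k \<ge> 2\<close> by (subst card_Diff_subset) (auto intro: finite_subset)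
  then have "phi (T - S) \<noteq> 0" using T'(5) by blast
  moreover have "phi S = 1 + phi (T - S)"
    using fin \<open>S \<subseteq> T\<close> T' by (intro phi_compl)
  ultimately show "phi S \<noteq> 1" by simp
qed

lemma block_edges_suspended_C4_free:
  assumes "k \<ge> 2"
  shows "\<not> suspended_C4 k (block_edges k)"
proof
  assume "suspended_C4 k (block_edges k)"
  then obtain S x y z w where S: "finite S" "card S = k - 2" "distinct [x, y, z, w]"
     "S \<inter> {x, y, z, w} = {}"
     and E: "S \<union> {x, y} \<in> block_edges k" "S \<union> {y, z} \<in> block_edges k"
       "S \<union> {z, w} \<in> block_edges k" "S \<union> {w, x} \<in> block_edges k"
    unfolding suspended_C4_def by metis
  define s where "s = \<Sum>S"
  have "phi S \<noteq> 1"
    using block_edgesD(4)[OF E(1) assms Un_upper1 S(2)] .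
  then have "1 + phi S \<noteq> 0"
    unfolding add_eq_0_iff_eq by (rule not_sym)
  have *: "polar (a + s) (b + s) = 1 + phi S"
    if "S \<union> {a, b} \<in> block_edges k" "a \<notin> S" "b \<notin> S" "a \<noteq> b" for a b
  proof -
    have "phi S + polar (a + s) (b + s) = 1"
      using phi_insert2[OF S(1) that(2-4)] block_edgesD(3)[OF that(1) assms] by (simp add: s_def)
    then show ?thesis by (metis add.commute add_self2)
  qed
  have comm: "{a, b} = {b, a}" for a b :: "'a \<times> 'a" by auto
  have "x + s = z + s"
    by (rule polar_C4_free[of _ "y + s" "1 + phi S" "w + s"])
      (use S E comm \<open>1 + phi S \<noteq> 0\<close> in \<open>auto intro!: * simp: insert_commute\<close>)
  then show False using S by simp
qed

lemma blocks_subset_full_sets: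
  assumes "k \<ge> 2"
  shows "blocks k \<subseteq> full_sets k V (block_edges k)"
proof
  fix T assume T: "T \<in> blocks k"
  then have "card T = k + 1" and "T \<subseteq> V" by (auto simp: blocks_def)
  then have fin: "finite T" using card.infinite by force
  have "e \<in> block_edges k" if e: "e \<subseteq> T" "card e = k" for e
  proof -
    have "card (T - e) = 1"
      using e \<open>card T = k + 1\<close> fin by (simp add: card_Diff_subset finite_subset)
    then obtain x where "T - e = {x}" by (auto simp: card_1_singleton_iff)
    then have "x \<in> T" "e = T - {x}" using e by auto
    then show ?thesis using T unfolding block_edges_def by blast
  qed
  then show "T \<in> full_sets k V (block_edges k)"
    using T by (auto simp: full_sets_def blocks_def)
qed

end

section \<open>Counting the cliques of the construction\<close>

context char2_plane
begin

section \<open>Generic point sets and their greedy count\<close>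

lemma V_add: "x \<in> V \<Longrightarrow> y \<in> V \<Longrightarrow> x + y \<in> V"
  by (auto simp: V_def add_K add_L)

lemma V_sum: "U \<subseteq> V \<Longrightarrow> \<Sum>U \<in> V"
proof (induction U rule: infinite_finite_induct)
  case (insert x F)
  then show ?case by (simp add: V_add)
qed (use zero_L L_subset_K in \<open>auto simp: V_def zero_prod_def\<close>)

text \<open>Nonzero second coordinates of subset sums ensure that each line
  \<open>polar x (\<Sum>A) = c\<close> is parametrised by the second coordinate, which ranges over
  \<open>L\<close>. The condition \<open>phi A \<noteq> 1\<close> keeps the points of
  \<open>U\<close> off the line used for completion, see \<open>polar_sum_ne\<close>. The condition
  on triples is general position.\<close>

definition generic :: "('a \<times> 'a) set \<Rightarrow> bool" where
  "generic U \<longleftrightarrow> U \<subseteq> V \<and> (\<forall>A \<subseteq> U. (A \<noteq> {} \<longrightarrow> snd (\<Sum>A) \<noteq> 0) \<and> phi A \<noteq> 1 \<and> (card A = 3 \<longrightarrow> phi A \<noteq> 0))"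

text \<open>Adding \<open>x\<close> to \<open>A\<close> changes the sum by \<open>x\<close> and
  \<open>phi\<close> by \<open>polar x (\<Sum>A)\<close>. The three families are the points that
  make the second coordinate of the new sum 0, the new \<open>phi\<close> 0, or the new
  \<open>phi\<close> 1. Singletons \<open>A\<close> in the first family also exclude the points of
  \<open>U\<close> themselves.\<close>

definition avoid :: "('a \<times> 'a) set \<Rightarrow> ('a \<times> 'a) set" where
  "avoid U = (\<Union>A \<in> Pow U. {x \<in> V. snd x = snd (\<Sum>A)}) \<union>
     (\<Union>A \<in> Pow U - {{}}. {x \<in> V. polar x (\<Sum>A) = phi A} \<union> {x \<in> V. polar x (\<Sum>A) = 1 + phi A})"

lemma genericD:
  assumes "generic U" "A \<subseteq> U"
  shows "A \<noteq> {} \<Longrightarrow> snd (\<Sum>A) \<noteq> 0" "phi A \<noteq> 1" "card A = 3 \<Longrightarrow> phi A \<noteq> 0"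
  using assms by (auto simp: generic_def)

lemma generic_finite: "generic U \<Longrightarrow> finite U"
  using finite_V finite_subset by (auto simp: generic_def)

lemma card_V_snd_eq: "card {x \<in> V. snd x = c} \<le> card K"
proof -
  have "{x \<in> V. snd x = c} \<subseteq> K \<times> {c}" by (auto simp: V_def)
  then have "card {x \<in> V. snd x = c} \<le> card (K \<times> {c})"
    using finite_K by (intro card_mono) auto
  then show ?thesis by (simp add: card_cartesian_product)
qed

text \<open>With \<open>snd s \<noteq> 0\<close> the equation recovers \<open>fst x\<close> from
  \<open>snd x\<close>, so the solutions project injectively to \<open>L\<close>.\<close>

lemma card_V_polar_eq:
  assumes "snd s \<noteq> 0"
  shows "card {x \<in> V. polar x s = c} \<le> card K"
proof -
  have "card {x \<in> V. polar x s = c} \<le> card L"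
  proof (rule card_inj_on_le[of snd])
    show "inj_on snd {x \<in> V. polar x s = c}"
    proof (rule inj_onI)
      fix x y assume xy: "x \<in> {x \<in> V. polar x s = c}" "y \<in> {x \<in> V. polar x s = c}" "snd x = snd y"
      then have "fst x * snd s = fst y * snd s"
        by (auto simp: polar_def)
      then show "x = y" using assms xy(3) by (simp add: prod_eq_iff)
    qed
  qed (use finite_K L_subset_K finite_subset in \<open>auto simp: V_def\<close>)
  also have "\<dots> \<le> card K" using finite_K L_subset_K by (rule card_mono)
  finally show ?thesis .
qed

text \<open>The factor 3 counts the families of \<open>avoid\<close>: each subset of
  \<open>U\<close> excludes at most three sets, each with at most \<open>card K\<close>
  points.\<close>

lemma card_avoid:
  assumes "generic U"
  shows "card (avoid U) \<le> 3 * 2 ^ card U * card K"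
proof -
  have fin: "finite (Pow U)" using generic_finite[OF assms] by simp
  have "card (\<Union>A \<in> Pow U. {x \<in> V. snd x = snd (\<Sum>A)}) \<le> (\<Sum>A\<in>Pow U. card K)"
    by (rule order_trans[OF card_UN_le[OF fin] sum_mono[OF card_V_snd_eq]])
  moreover have "card (\<Union>A \<in> Pow U - {{}}. {x \<in> V. polar x (\<Sum>A) = phi A} \<union> {x \<in> V. polar x (\<Sum>A) = 1 + phi A})
      \<le> (\<Sum>A\<in>Pow U - {{}}. card K + card K)"
  proof (rule order_trans[OF card_UN_le[OF finite_Diff[OF fin]] sum_mono])
    fix A assume "A \<in> Pow U - {{}}"
    then have "snd (\<Sum>A) \<noteq> 0" using genericD(1)[OF assms] by blast
    from card_V_polar_eq[OF this] show "card ({x \<in> V. polar x (\<Sum>A) = phi A} \<union> {x \<in> V. polar x (\<Sum>A) = 1 + phi A})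
        \<le> card K + card K"
      by (intro order_trans[OF card_Un_le] add_mono)
  qed
  moreover have "(\<Sum>A\<in>Pow U - {{}}. card K + card K) \<le> (\<Sum>A\<in>Pow U. card K + card K)"
    using fin by (intro sum_mono2) auto
  moreover have "card (Pow U) = 2 ^ card U"
    using generic_finite[OF assms] by (rule card_Pow)
  ultimately show ?thesis
    unfolding avoid_def by (intro order_trans[OF card_Un_le]) (simp add: algebra_simps)
qed

lemma generic_insert:
  assumes "generic U" "x \<in> V - avoid U"
  shows "x \<notin> U" "generic (insert x U)"
proof -
  have snd: "snd x \<noteq> snd (\<Sum>A)" if "A \<subseteq> U" for A
    using assms(2) that by (auto simp: avoid_def)
  have pol: "polar x (\<Sum>A) \<noteq> phi A" "polar x (\<Sum>A) \<noteq> 1 + phi A" if "A \<subseteq> U" "A \<noteq> {}" for A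
    using assms(2) that by (auto simp: avoid_def)
  show x: "x \<notin> U"
    using snd[of "{x}"] by auto
  have "(A \<noteq> {} \<longrightarrow> snd (\<Sum>A) \<noteq> 0) \<and> phi A \<noteq> 1 \<and> (card A = 3 \<longrightarrow> phi A \<noteq> 0)"
    if A: "A \<subseteq> insert x U" for A
  proof (cases "x \<in> A")
    case False
    then have "A \<subseteq> U" using A by auto
    then show ?thesis using assms(1) by (simp add: generic_def)
  next
    case True
    define B where "B = A - {x}"
    have B: "A = insert x B" "x \<notin> B" "B \<subseteq> U"
      using True A by (auto simp: B_def)
    have fin: "finite B" using B(3) generic_finite[OF assms(1)] finite_subset by blast
    have "snd (\<Sum>A) \<noteq> 0"
      using snd[OF B(3)] B fin by (simp add: add_eq_0_iff_eq)
    moreover have phi: "phi A = phi B + polar x (\<Sum>B)"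
      using phi_insert[OF fin B(2)] B(1) by simp
    have "phi A \<noteq> 1"
    proof (cases "B = {}")
      case True
      then show ?thesis using B(1) by (simp add: phi_def char2)
    next
      case False
      then show ?thesis
        using pol(2)[OF B(3)] phi by (metis add.commute add_self2)
    qed
    moreover have "phi A \<noteq> 0" if "card A = 3"
    proof -
      have "B \<noteq> {}" using that B by auto
      then show ?thesis
        using pol(1)[OF B(3)] phi by (metis add_eq_0_iff_eq)
    qed
    ultimately show ?thesis by blast
  qed
  then show "generic (insert x U)"
    using assms by (auto simp: generic_def)
qed

definition generic_lists :: "nat \<Rightarrow> ('a \<times> 'a) list set" where
  "generic_lists r = {xs. length xs = r \<and> distinct xs \<and> generic (set xs)}"

lemma finite_generic_lists: "finite (generic_lists r)"
proof (rule finite_subset)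
  show "generic_lists r \<subseteq> {xs. set xs \<subseteq> V \<and> length xs = r}"
    by (auto simp: generic_lists_def generic_def)
  show "finite {xs. set xs \<subseteq> V \<and> length xs = r}"
    by (rule finite_lists_length_eq[OF finite_V])
qed

lemma card_V: "card V = card K * card L"
  by (simp add: V_def card_cartesian_product)

text \<open>Greedy choice, one point at a time. The exponent in \<open>2 ^ r\<close> is kept fixed
  while \<open>i\<close> grows, so that every step has the same number of guaranteed choices and the
  product is a power.\<close>

lemma card_generic_lists:
  assumes "i \<le> r"
  shows "(card V - 3 * 2 ^ r * card K) ^ i \<le> card (generic_lists i)"
  using assms
proof (induction i)
  case 0
  have "generic {}"
    using phi_empty by (simp add: generic_def)
  then have "generic_lists 0 = {[]}"
    by (auto simp: generic_lists_def)
  then show ?case by simp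
next
  case (Suc i)
  have "(\<lambda>(xs, x). x # xs) ` Sigma (generic_lists i) (\<lambda>xs. V - avoid (set xs)) \<subseteq> generic_lists (Suc i)"
    using generic_insert by (fastforce simp: generic_lists_def)
  moreover have "inj_on (\<lambda>(xs, x). x # xs) (Sigma (generic_lists i) (\<lambda>xs. V - avoid (set xs)))"
    by (auto simp: inj_on_def)
  ultimately have "card (Sigma (generic_lists i) (\<lambda>xs. V - avoid (set xs))) \<le> card (generic_lists (Suc i))"
    using finite_generic_lists by (metis card_image card_mono)
  moreover have "card (Sigma (generic_lists i) (\<lambda>xs. V - avoid (set xs))) =
      (\<Sum>xs\<in>generic_lists i. card (V - avoid (set xs)))"
    using finite_generic_lists finite_V by (subst card_SigmaI) auto
  moreover have "(\<Sum>xs\<in>generic_lists i. card V - 3 * 2 ^ r * card K) \<le> (\<Sum>xs\<in>generic_lists i. card (V - avoid (set xs)))"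
  proof (rule sum_mono)
    fix xs assume "xs \<in> generic_lists i"
    then have xs: "generic (set xs)" "card (set xs) = i"
      by (auto simp: generic_lists_def distinct_card)
    have "card (avoid (set xs)) \<le> 3 * 2 ^ i * card K"
      using card_avoid[OF xs(1)] xs(2) by simp
    also have "\<dots> \<le> 3 * 2 ^ r * card K"
      using Suc.prems by simp
    finally have "card (avoid (set xs)) \<le> 3 * 2 ^ r * card K" .
    moreover have "finite (avoid (set xs))"
      by (rule finite_subset[OF _ finite_V]) (auto simp: avoid_def)
    ultimately show "card V - 3 * 2 ^ r * card K \<le> card (V - avoid (set xs))"
      using diff_card_le_card_Diff[of "avoid (set xs)" V] by linarith
  qed
  ultimately have "card (generic_lists i) * (card V - 3 * 2 ^ r * card K) \<le> card (generic_lists (Suc i))"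
    unfolding sum_constant of_nat_id by linarith
  moreover have "(card V - 3 * 2 ^ r * card K) ^ i \<le> card (generic_lists i)"
    using Suc by simp
  ultimately show ?case
    unfolding power_Suc2 using mult_le_mono1 order_trans by blast
qed

section \<open>Completing a generic set along a line\<close>

lemma polar_add: "polar (x + y) z = polar x z + (polar y z :: 'a)"
  by (simp add: polar_def algebra_simps)

lemma polar_add_right: "polar x (y + z) = polar x y + (polar x z :: 'a)"
  by (simp add: polar_def algebra_simps)

lemma polar_zero: "polar x 0 = (0 :: 'a)"
  by (simp add: polar_def)

lemma polar_commute: "polar x y = (polar y x :: 'a)"
  by (simp add: polar_def algebra_simps)

lemma polar_self: "polar x x = (0 :: 'a)"
  by (simp add: polar_def mult.commute char2)

text \<open>In dimension 2 the vectors orthogonal to \<open>v\<close> are its multiples, and any two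
  of these are parallel.\<close>

lemma polar_parallel:
  assumes "polar w v = 0" "polar s v = 0" "v \<noteq> 0"
  shows "polar w s = (0 :: 'a)"
proof -
  have "polar w s * fst v = 0" "polar w s * snd v = 0"
    using polar_cramer[of s v w] assms(1,2) by simp_all
  then show ?thesis
    using assms(3) by (auto simp: prod_eq_iff)
qed

text \<open>Removing \<open>x\<close> from \<open>U\<close> changes \<open>phi\<close> by
  \<open>polar x (\<Sum>(U - {x}))\<close>, which equals \<open>polar (\<Sum>U) x\<close> because
  the form is alternating. Equality would therefore give \<open>phi (U - {x}) = 1\<close>.\<close>

lemma polar_sum_ne:
  assumes "generic U" "x \<in> U"
  shows "polar (\<Sum>U) x \<noteq> 1 + phi U"
proof
  assume eq: "polar (\<Sum>U) x = 1 + phi U"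
  have fin: "finite U" using generic_finite assms(1) .
  define A where "A = U - {x}"
  have U: "U = insert x A" "x \<notin> A" "finite A"
    using assms(2) fin by (auto simp: A_def)
  have "phi U = phi A + polar x (\<Sum>A)"
    using U by (simp add: phi_insert)
  moreover have "polar (\<Sum>U) x = polar x (\<Sum>A)"
    using U by (simp add: polar_add polar_self) (rule polar_commute)
  ultimately have "phi U = phi A + 1 + phi U"
    unfolding eq by (simp only: add.assoc)
  then have "phi A + 1 = 0"
    by (simp only: add_cancel_right_left)
  then have "phi A = 1"
    unfolding add_eq_0_iff_eq .
  moreover have "phi A \<noteq> 1"
    using genericD(2)[OF assms(1)] by (simp add: A_def)
  ultimately show False by simp
qed

text \<open>The right-hand side vanishes exactly if \<open>w\<close> lies on the line through
  \<open>a\<close> and \<open>b\<close>.\<close>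

lemma phi_pair_polar:
  assumes "a \<noteq> b"
  shows "phi {a, b} + polar w (a + b) = (polar (w + a) (a + b) :: 'a)"
  using assms by (simp add: phi_def quad_def polar_def algebra_simps char2_simps)

text \<open>Two lines meet in at most one point unless they coincide. If the completion line and the
  line through \<open>A = {a, b}\<close> shared two points, they would have the same direction, so
  \<open>a\<close> would lie on the completion line, against \<open>polar_sum_ne\<close>.\<close>

lemma line_pair_unique:
  assumes "generic U" "A \<subseteq> U" "card A = 2"
    and w: "polar (\<Sum>U) w = 1 + phi U" "phi A + polar w (\<Sum>A) = 0"
    and w': "polar (\<Sum>U) w' = 1 + phi U" "phi A + polar w' (\<Sum>A) = 0"
  shows "w = w'"
proof (rule ccontr)
  assume "w \<noteq> w'"
  then have ne: "w + w' \<noteq> 0"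
    by (metis pair_char2 add_right_cancel)
  obtain a b where A: "A = {a, b}" "a \<noteq> b"
    using assms(3) by (auto simp: card_2_iff)
  then have sum: "\<Sum>A = a + b" by simp
  have "snd (a + b) \<noteq> 0"
    using genericD(1)[OF assms(1,2)] A sum by simp
  then have ab: "a + b \<noteq> 0" by (metis snd_zero)
  have "polar w (\<Sum>A) = polar w' (\<Sum>A)"
    using w(2) w'(2) unfolding add_eq_0_iff_eq by (rule trans[OF sym])
  then have 1: "polar (a + b) (w + w') = 0"
    by (simp add: sum polar_add_right polar_commute[of "a + b"] char2)
  have 2: "polar (\<Sum>U) (w + w') = 0"
    using w(1) w'(1) by (simp add: polar_add_right char2)
  have "polar (\<Sum>U) (a + b) = 0"
    by (rule polar_parallel[OF 2 1 ne])
  moreover have "polar (w + a) (a + b) = 0"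
    using w(2) phi_pair_polar[OF A(2), of w] A by simp
  ultimately have "polar (w + a) (\<Sum>U) = 0"
    using polar_parallel ab by blast
  then have "polar (\<Sum>U) w + polar (\<Sum>U) a = 0"
    by (simp only: polar_add_right polar_commute[of "w + a"])
  then have "polar (\<Sum>U) a = polar (\<Sum>U) w"
    unfolding add_eq_0_iff_eq by (rule sym)
  then show False
    using w(1) polar_sum_ne[OF assms(1), of a] A assms(2) by simp
qed

text \<open>A generic set \<open>U\<close> of size \<open>k - 1\<close> is completed by a pair \<open>y, \<Sum>U + y\<close>: the sum is then 0, and the
  condition on the quadratic form says that \<open>y\<close> lies on a certain line.\<close>

lemma complete_block:
  assumes U: "generic U" "U \<noteq> {}" and y: "y \<in> V" "polar (\<Sum>U) y = 1 + phi U"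
    and pairs: "\<forall>A. A \<subseteq> U \<longrightarrow> card A = 2 \<longrightarrow> phi A + polar y (\<Sum>A) \<noteq> 0"
      "\<forall>A. A \<subseteq> U \<longrightarrow> card A = 2 \<longrightarrow> phi A + polar (\<Sum>U + y) (\<Sum>A) \<noteq> 0"
  shows "y \<notin> U" "\<Sum>U + y \<notin> U" "\<Sum>U + y \<noteq> y" "insert (\<Sum>U + y) (insert y U) \<in> blocks (card U + 1)"
proof -
  define z where "z = \<Sum>U + y"
  have z: "polar (\<Sum>U) z = 1 + phi U"
    using y(2) by (simp add: z_def polar_add_right polar_self)
  have fin: "finite U" using generic_finite U(1) .
  have "U \<subseteq> V" using U(1) by (simp add: generic_def)
  show "y \<notin> U" using polar_sum_ne[OF U(1)] y(2) by blast
  have "z \<notin> U" using polar_sum_ne[OF U(1)] z by blast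
  then show "\<Sum>U + y \<notin> U" by (simp add: z_def)
  have "snd (\<Sum>U) \<noteq> 0" using genericD(1)[OF U(1) order_refl U(2)] .
  then have "z \<noteq> y" unfolding z_def by (metis add_cancel_left_left snd_zero)
  then show "\<Sum>U + y \<noteq> y" by (simp add: z_def)
  define T where "T = insert z (insert y U)"
  have "T \<subseteq> V"
    using V_add[OF V_sum[OF \<open>U \<subseteq> V\<close>] y(1)] y(1) \<open>U \<subseteq> V\<close> by (simp add: T_def z_def)
  moreover have "card T = card U + 1 + 1"
    using fin \<open>y \<notin> U\<close> \<open>z \<notin> U\<close> \<open>z \<noteq> y\<close> by (simp add: T_def)
  moreover have "\<Sum>T = 0"
  proof -
    have "\<Sum>T = z + (y + \<Sum>U)"
      using fin \<open>y \<notin> U\<close> \<open>z \<notin> U\<close> \<open>z \<noteq> y\<close> by (simp add: T_def)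
    also have "y + \<Sum>U = z" by (simp add: z_def add.commute)
    finally show ?thesis by (simp add: pair_char2)
  qed
  moreover have "sum quad T = 1"
  proof -
    have "sum quad T = quad z + (quad y + sum quad U)"
      using fin \<open>y \<notin> U\<close> \<open>z \<notin> U\<close> \<open>z \<noteq> y\<close> by (simp add: T_def)
    also have "\<dots> = phi U + polar (\<Sum>U) y"
      by (simp add: z_def phi_def quad_def polar_def algebra_simps char2_simps)
    also have "\<dots> = 1"
      unfolding y(2) by (simp add: algebra_simps char2_simps)
    finally show ?thesis .
  qed
  moreover have "phi A \<noteq> 0" if A: "A \<subseteq> T" "card A = 3" for A
  proof -
    define B where "B = A - {y, z}"
    have B: "B \<subseteq> U" "finite B" "y \<notin> B" "z \<notin> B"
      using A fin by (auto simp: B_def T_def intro: finite_subset)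
    consider "A = B" | "A = insert y B" | "A = insert z B" | "A = insert y (insert z B)"
      unfolding B_def by blast
    then show ?thesis
    proof cases
      case 1
      then show ?thesis using genericD(3)[OF U(1) B(1)] A by simp
    next
      case 2
      then have "card B = 2" using A B by simp
      then show ?thesis using pairs(1) B(1) 2 B by (simp add: phi_insert)
    next
      case 3
      then have "card B = 2" using A B by simp
      then show ?thesis using pairs(2) B(1) 3 B by (simp add: phi_insert z_def)
    next
      case 4
      then have "card B = 1" using A B \<open>z \<noteq> y\<close> by simp
      then obtain x where x: "B = {x}" by (auto simp: card_1_singleton_iff)
      \<comment> \<open>The remaining triples consist of both new points and one old point
        \<open>x\<close>. Substituting \<open>z = \<Sum>U + y\<close> reduces collinearity to
        \<open>polar (\<Sum>U) x = polar (\<Sum>U) y\<close>, that is, to \<open>x\<close> lying on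
        the completion line.\<close>
      have "phi A = polar y (z + x) + polar z x"
        using 4 x B \<open>z \<noteq> y\<close> by (simp add: phi_insert phi_empty polar_zero)
      also have "\<dots> = polar (\<Sum>U) y + polar (\<Sum>U) x"
        by (simp add: z_def polar_def algebra_simps char2_simps)
      finally show ?thesis
        using polar_sum_ne[OF U(1), of x] y(2) x B by (simp add: add_eq_0_iff_eq)
    qed
  qed
  ultimately show "insert (\<Sum>U + y) (insert y U) \<in> blocks (card U + 1)"
    by (simp add: blocks_def T_def z_def)
qed

text \<open>The equation of the completion line solved for the first coordinate, the second being
  \<open>t\<close>; addition serves as subtraction.\<close>

definition line_point :: "('a \<times> 'a) set \<Rightarrow> 'a \<Rightarrow> 'a \<times> 'a" where
  "line_point U t = ((1 + phi U + fst (\<Sum>U) * t) * inverse (snd (\<Sum>U)), t)"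

lemma phi_K:
  assumes "U \<subseteq> V"
  shows "phi U \<in> K"
proof -
  have "quad x \<in> K" if "x \<in> V" for x
    using that L_subset_K by (auto simp: V_def quad_def mult_K)
  moreover have "sum quad U \<in> K"
    using assms calculation by (induction U rule: infinite_finite_induct)
      (use zero_L L_subset_K add_K in auto)
  ultimately show ?thesis
    using V_sum[OF assms] by (simp add: phi_def add_K)
qed

lemma line_point:
  assumes "generic U" "U \<noteq> {}" "t \<in> L"
  shows "line_point U t \<in> V" "polar (\<Sum>U) (line_point U t) = 1 + phi U"
proof -
  have "U \<subseteq> V" using assms(1) by (simp add: generic_def)
  from V_sum[OF this] have "fst (\<Sum>U) \<in> K" "snd (\<Sum>U) \<in> K" using L_subset_K by (auto simp: V_def)
  then show "line_point U t \<in> V"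
    using assms(3) L_subset_K phi_K[OF \<open>U \<subseteq> V\<close>]
    by (auto simp: line_point_def V_def intro!: add_K mult_K inverse_K one_K)
  have "snd (\<Sum>U) \<noteq> 0" using genericD(1)[OF assms(1) order_refl assms(2)] .
  then have "polar (\<Sum>U) (line_point U t) = fst (\<Sum>U) * t + (1 + phi U + fst (\<Sum>U) * t)"
    by (simp add: polar_def line_point_def field_simps)
  then show "polar (\<Sum>U) (line_point U t) = 1 + phi U"
    by (simp add: algebra_simps char2_simps)
qed

definition good_params :: "('a \<times> 'a) set \<Rightarrow> 'a set" where
  "good_params U = L - (\<Union>A \<in> {A. A \<subseteq> U \<and> card A = 2}.
     {t \<in> L. phi A + polar (line_point U t) (\<Sum>A) = 0} \<union>
     {t \<in> L. phi A + polar (\<Sum>U + line_point U t) (\<Sum>A) = 0})"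

lemma finite_L: "finite L"
  using finite_K L_subset_K finite_subset by blast

text \<open>By \<open>line_pair_unique\<close>, each pair of points of \<open>U\<close> rules out at
  most one parameter for each of the two new points. The second new point lies on the same line
  because \<open>polar (\<Sum>U) (\<Sum>U) = 0\<close>.\<close>

lemma card_good_params:
  assumes U: "generic U" "U \<noteq> {}"
  shows "card L - 2 * 2 ^ card U \<le> card (good_params U)"
proof -
  let ?P = "{A. A \<subseteq> U \<and> card A = 2}"
  let ?F = "\<lambda>A. {t \<in> L. phi A + polar (line_point U t) (\<Sum>A) = 0}"
  let ?G = "\<lambda>A. {t \<in> L. phi A + polar (\<Sum>U + line_point U t) (\<Sum>A) = 0}"
  have fin: "finite U" using generic_finite U(1) .
  have snd: "snd (line_point U t) = t" for t by (simp add: line_point_def)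
  have F: "card (?F A) \<le> 1" if A: "A \<subseteq> U" "card A = 2" for A
  proof -
    have "t = t'" if "t \<in> ?F A" "t' \<in> ?F A" for t t'
    proof -
      have "line_point U t = line_point U t'"
        by (intro line_pair_unique[OF U(1) A] line_point(2)[OF U]) (use that in auto)
      then show ?thesis by (simp add: line_point_def)
    qed
    then have "\<forall>t \<in> ?F A. \<forall>t' \<in> ?F A. t = t'" by blast
    moreover have "finite (?F A)" using finite_L by simp
    ultimately show ?thesis by (simp only: One_nat_def card_le_Suc0_iff_eq)
  qed
  have G: "card (?G A) \<le> 1" if A: "A \<subseteq> U" "card A = 2" for A
  proof -
    have "polar (\<Sum>U) (\<Sum>U + line_point U t) = 1 + phi U" if "t \<in> L" for t
      using line_point(2)[OF U that] by (simp add: polar_add_right polar_self)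
    note on_line = this
    have "t = t'" if "t \<in> ?G A" "t' \<in> ?G A" for t t'
    proof -
      have "\<Sum>U + line_point U t = \<Sum>U + line_point U t'"
        by (intro line_pair_unique[OF U(1) A] on_line) (use that in auto)
      then show ?thesis by (simp add: line_point_def)
    qed
    then have "\<forall>t \<in> ?G A. \<forall>t' \<in> ?G A. t = t'" by blast
    moreover have "finite (?G A)" using finite_L by simp
    ultimately show ?thesis by (simp only: One_nat_def card_le_Suc0_iff_eq)
  qed
  have "card (\<Union>A \<in> ?P. ?F A \<union> ?G A) \<le> (\<Sum>A\<in>?P. card (?F A \<union> ?G A))"
    using fin by (intro card_UN_le) simp
  also have "\<dots> \<le> (\<Sum>A\<in>?P. 2)"
  proof (rule sum_mono)
    fix A assume "A \<in> ?P"
    then show "card (?F A \<union> ?G A) \<le> 2"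
      using F[of A] G[of A] card_Un_le[of "?F A" "?G A"] by auto
  qed
  also have "\<dots> = 2 * card ?P" by simp
  also have "card ?P \<le> card (Pow U)"
    using fin by (intro card_mono) auto
  also have "card (Pow U) = 2 ^ card U" using fin by (rule card_Pow)
  finally have "card (\<Union>A \<in> ?P. ?F A \<union> ?G A) \<le> 2 * 2 ^ card U" by simp
  moreover have "finite (\<Union>A \<in> ?P. ?F A \<union> ?G A)"
    using fin finite_L by simp
  ultimately show ?thesis
    unfolding good_params_def
    using diff_card_le_card_Diff[of "\<Union>A \<in> ?P. ?F A \<union> ?G A" L] by linarith
qed

text \<open>A generic list of length \<open>k - 1\<close> together with a good parameter yields an
  ordered block, and every block has \<open>(k + 1)!\<close> orderings. The subtracted
  \<open>2 ^ k\<close> is \<open>2 * 2 ^ (k - 1)\<close> from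
  \<open>card_good_params\<close>.\<close>

lemma card_blocks:
  assumes "k \<ge> 2"
  shows "(card V - 3 * 2 ^ k * card K) ^ (k - 1) * (card L - 2 ^ k) \<le> fact (k + 1) * card (blocks k)"
proof -
  define f where "f = (\<lambda>(xs, t). (\<Sum>(set xs) + line_point (set xs) t) # line_point (set xs) t # xs)"
  define S where "S = Sigma (generic_lists (k - 1)) (\<lambda>xs. good_params (set xs))"
  define R where "R = (\<lambda>T. {zs :: ('a \<times> 'a) list. length zs = k + 1 \<and> distinct zs \<and> set zs \<subseteq> T})"
  have fin_blocks: "finite (blocks k)"
    using finite_V by (auto simp: blocks_def intro: finite_subset[of _ "Pow V"])
  have gl: "generic (set xs)" "set xs \<noteq> {}" "card (set xs) = k - 1" "distinct xs" "length xs = k - 1"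
    if "xs \<in> generic_lists (k - 1)" for xs
    using that assms by (auto simp: generic_lists_def distinct_card)
  \<comment> \<open>The tail of the list is \<open>xs\<close>, and the second coordinate of its
    second entry is \<open>t\<close>.\<close>
  have "inj_on f S"
    by (auto simp: inj_on_def f_def line_point_def)
  moreover have "f ` S \<subseteq> (\<Union>T \<in> blocks k. R T)"
  proof safe
    fix xs t assume "(xs, t) \<in> S"
    then have xs: "xs \<in> generic_lists (k - 1)" and t: "t \<in> good_params (set xs)"
      by (auto simp: S_def)
    from t have "t \<in> L" by (simp add: good_params_def)
    note lp = line_point[OF gl(1,2)[OF xs] this]
    have pairs: "\<forall>A. A \<subseteq> set xs \<longrightarrow> card A = 2 \<longrightarrow> phi A + polar (line_point (set xs) t) (\<Sum>A) \<noteq> 0"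
      "\<forall>A. A \<subseteq> set xs \<longrightarrow> card A = 2 \<longrightarrow> phi A + polar (\<Sum>(set xs) + line_point (set xs) t) (\<Sum>A) \<noteq> 0"
      using t by (auto simp: good_params_def)
    note block = complete_block[OF gl(1,2)[OF xs] lp pairs]
    have "set (f (xs, t)) \<in> blocks k"
      using block(4) gl(3)[OF xs] assms by (simp add: f_def)
    moreover have "distinct (f (xs, t))"
      using block(1-3) gl(4)[OF xs] by (simp add: f_def)
    moreover have "length (f (xs, t)) = k + 1"
      using gl(5)[OF xs] assms by (simp add: f_def)
    ultimately have "set (f (xs, t)) \<in> blocks k \<and> f (xs, t) \<in> R (set (f (xs, t)))"
      by (simp add: R_def)
    then show "f (xs, t) \<in> (\<Union>T \<in> blocks k. R T)"
      by blast
  qed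
  moreover have fin_R: "finite (R T)" and card_R: "card (R T) = fact (k + 1)" if "T \<in> blocks k" for T
  proof -
    have "card T = k + 1" using that by (simp add: blocks_def)
    then have "finite T" by (simp add: card_ge_0_finite)
    have "R T \<subseteq> {zs. set zs \<subseteq> T \<and> length zs = k + 1}" by (auto simp: R_def)
    then show "finite (R T)"
      by (rule finite_subset) (rule finite_lists_length_eq[OF \<open>finite T\<close>])
    have "card (R T) = \<Prod>{card T - (k + 1) + 1 .. card T}"
      unfolding R_def by (rule card_lists_distinct_length_eq) (use \<open>finite T\<close> \<open>card T = k + 1\<close> in auto)
    then show "card (R T) = fact (k + 1)"
      using \<open>card T = k + 1\<close> by (simp add: fact_prod)
  qed
  ultimately have "card S \<le> card (\<Union>T \<in> blocks k. R T)"
    using fin_blocks by (intro card_inj_on_le) auto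
  also have "\<dots> \<le> (\<Sum>T\<in>blocks k. card (R T))"
    using fin_blocks by (rule card_UN_le)
  also have "\<dots> = fact (k + 1) * card (blocks k)"
    using card_R by simp
  finally have upper: "card S \<le> fact (k + 1) * card (blocks k)" .
  have "card (generic_lists (k - 1)) * (card L - 2 ^ k) = (\<Sum>xs\<in>generic_lists (k - 1). card L - 2 ^ k)"
    by simp
  also have "\<dots> \<le> (\<Sum>xs\<in>generic_lists (k - 1). card (good_params (set xs)))"
  proof (rule sum_mono)
    fix xs assume xs: "xs \<in> generic_lists (k - 1)"
    have "2 * 2 ^ (k - 1) = (2 :: nat) ^ k"
      using assms by (simp flip: power_Suc)
    then show "card L - 2 ^ k \<le> card (good_params (set xs))"
      using card_good_params[OF gl(1,2)[OF xs]] gl(3)[OF xs] by simp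
  qed
  also have "\<dots> = card S"
    unfolding S_def using finite_generic_lists finite_L
    by (subst card_SigmaI) (auto simp: good_params_def)
  finally have "card (generic_lists (k - 1)) * (card L - 2 ^ k) \<le> card S" .
  moreover have "(card V - 3 * 2 ^ k * card K) ^ (k - 1) \<le> card (generic_lists (k - 1))"
    by (rule card_generic_lists) simp
  ultimately show ?thesis
    using upper mult_le_mono1 order_trans by meson
qed

end

section \<open>Transfer to hypergraphs on the natural numbers\<close>

lemma suspended_C4_image:
  assumes "inj_on f V" "\<And>e. e \<in> E \<Longrightarrow> e \<subseteq> V" "suspended_C4 k ((`) f ` E)"
  shows "suspended_C4 k E"
proof -
  obtain S x y z w where S: "finite S" "card S = k - 2" "distinct [x, y, z, w]" "S \<inter> {x, y, z, w} = {}"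
    and E: "S \<union> {x, y} \<in> (`) f ` E" "S \<union> {y, z} \<in> (`) f ` E" "S \<union> {z, w} \<in> (`) f ` E" "S \<union> {w, x} \<in> (`) f ` E"
    using assms(3) unfolding suspended_C4_def by metis
  define g where "g = inv_into V f"
  have sub: "e \<subseteq> f ` V" and pull: "g ` e \<in> E" if "e \<in> (`) f ` E" for e
  proof -
    obtain e' where e': "e' \<in> E" "e = f ` e'" using \<open>e \<in> (`) f ` E\<close> by blast
    then show "e \<subseteq> f ` V" using assms(2) by blast
    have "g ` e = e'"
      unfolding g_def e'(2) using assms(1,2) e'(1) by (simp add: inv_into_image_cancel)
    then show "g ` e \<in> E" using e'(1) by simp
  qed
  have all: "S \<union> {x, y, z, w} \<subseteq> f ` V"
    using sub[OF E(1)] sub[OF E(3)] by auto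
  have inj: "inj_on g (S \<union> {x, y, z, w})"
    unfolding g_def by (rule inj_on_inv_into[OF all])
  have "card (g ` S) = k - 2"
    using S(2) inj by (subst card_image) (auto intro: inj_on_subset)
  moreover have "distinct [g x, g y, g z, g w]"
    using S(3) inj_on_eq_iff[OF inj] by simp
  moreover have "g ` S \<inter> {g x, g y, g z, g w} = {}"
    using S(4) inj_on_image_Int[OF inj Un_upper1 Un_upper2] by simp
  moreover have "g ` S \<union> {g x, g y} \<in> E" "g ` S \<union> {g y, g z} \<in> E"
    "g ` S \<union> {g z, g w} \<in> E" "g ` S \<union> {g w, g x} \<in> E"
    using pull[OF E(1)] pull[OF E(2)] pull[OF E(3)] pull[OF E(4)] by (simp_all add: image_Un)
  ultimately show ?thesis
    using S(1) unfolding suspended_C4_def by (meson finite_imageI)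
qed

lemma finite_full_sets: "finite V \<Longrightarrow> finite (full_sets k V E)"
  by (rule finite_subset[of _ "Pow V"]) (auto simp: full_sets_def)

lemma card_full_sets_image:
  assumes "inj_on f V" "finite V"
  shows "card (full_sets k V E) \<le> card (full_sets k (f ` V) ((`) f ` E))"
proof (rule card_inj_on_le)
  show "inj_on ((`) f) (full_sets k V E)"
    by (rule inj_on_subset[OF inj_on_image_Pow[OF assms(1)]]) (auto simp: full_sets_def)
  show "(`) f ` full_sets k V E \<subseteq> full_sets k (f ` V) ((`) f ` E)"
  proof safe
    fix T assume T: "T \<in> full_sets k V E"
    then have T': "T \<subseteq> V" "card T = k + 1" "\<And>e. e \<subseteq> T \<Longrightarrow> card e = k \<Longrightarrow> e \<in> E"
      unfolding full_sets_def by blast+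
    have inj: "inj_on f T" using assms(1) T'(1) by (rule inj_on_subset)
    have "e \<in> (`) f ` E" if "e \<subseteq> f ` T" "card e = k" for e
    proof -
      define e' where "e' = T \<inter> f -` e"
      have e': "e' \<subseteq> T" "e = f ` e'" using that(1) by (auto simp: e'_def)
      have "card e' = k"
        using card_image[OF inj_on_subset[OF inj e'(1)]] e'(2) that(2) by simp
      then have "e' \<in> E" by (rule T'(3)[OF e'(1)])
      then show ?thesis unfolding e'(2) by (rule imageI)
    qed
    moreover have "f ` T \<subseteq> f ` V" "card (f ` T) = k + 1"
      using T'(1,2) card_image[OF inj] by auto
    ultimately show "f ` T \<in> full_sets k (f ` V) ((`) f ` E)"
      unfolding full_sets_def by blast
  qed
  show "finite (full_sets k (f ` V) ((`) f ` E))"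
    using assms(2) by (intro finite_full_sets) simp
qed

text \<open>With \<open>M = card K * l\<close>, the quantity \<open>M / l\<close> is
  \<open>card K\<close>. Bernoulli's inequality turns the product into the main term
  \<open>M ^ r * l\<close> minus an error of order \<open>M ^ r\<close>. If \<open>a\<close> or
  \<open>b\<close> exceeds \<open>l\<close>, the claimed lower bound is at most 0, which also covers
  small fields.\<close>

lemma real_count_bound:
  fixes a :: real
  assumes "a \<ge> 0" "b \<ge> 0" "l > 0" "r > 0"
    and "a \<le> l \<Longrightarrow> b \<le> l \<Longrightarrow> (M - a * (M / l)) ^ r * (l - b) \<le> N"
    and "M \<ge> 0" "N \<ge> 0"
  shows "M ^ r * l - (real r * a + b) * M ^ r \<le> N"
proof (cases "a \<le> l \<and> b \<le> l")
  case True
  have "1 + real r * (- (a / l)) \<le> (1 + - (a / l)) ^ r"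
    using True assms(3) by (intro Bernoulli_inequality) auto
  then have "M ^ r * ((1 - real r * a / l) * (l - b)) \<le> M ^ r * ((1 - a / l) ^ r * (l - b))"
    using True assms(1-4,6) by (intro mult_left_mono mult_right_mono) auto
  also have "\<dots> = (M * (1 - a / l)) ^ r * (l - b)"
    by (simp only: power_mult_distrib mult.assoc)
  also have "\<dots> = (M - a * (M / l)) ^ r * (l - b)"
    by (simp add: right_diff_distrib mult.commute)
  also have "\<dots> \<le> N" using True assms(5) by simp
  finally have *: "M ^ r * ((1 - real r * a / l) * (l - b)) \<le> N" .
  define c where "c = real r * a / l"
  have c: "c \<ge> 0" "c * l = real r * a"
    using assms(1,3) by (simp_all add: c_def)
  have "(1 - c) * (l - b) = l - (c * l + b) + c * b"
    by (simp add: algebra_simps)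
  then have "l - (real r * a + b) \<le> (1 - c) * (l - b)"
    using c assms(2) by simp
  then have "M ^ r * (l - (real r * a + b)) \<le> M ^ r * ((1 - c) * (l - b))"
    using assms(6) by (intro mult_left_mono) auto
  with * have "M ^ r * (l - (real r * a + b)) \<le> N"
    unfolding c_def by linarith
  then show ?thesis by (simp only: right_diff_distrib mult.commute)
next
  case False
  have "a \<le> real r * a"
    using assms(1,4) mult_right_mono[of 1 "real r" a] by simp
  then have "l \<le> real r * a + b"
    using False assms(1,2) by linarith
  then have "M ^ r * l \<le> M ^ r * (real r * a + b)"
    using assms(6) by (intro mult_left_mono) auto
  then show ?thesis using assms(7) by (simp add: mult.commute)
qed

lemma dense_suspended_C4_free:
  fixes k :: nat
  assumes "k \<ge> 2"
  obtains C :: real where "C \<ge> 0"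
    "\<And>m j. m > 0 \<Longrightarrow> j \<le> 1 \<Longrightarrow> \<exists>(V :: nat set) E. finite V \<and> card V = 2 ^ m * 2 ^ (m - j) \<and>
      (\<forall>e \<in> E. e \<subseteq> V \<and> card e = k) \<and> \<not> suspended_C4 k E \<and>
      real (card V) ^ (k - 1) * 2 ^ (m - j) - C * real (card V) ^ (k - 1)
        \<le> fact (k + 1) * real (card (full_sets k V E))"
proof
  \<comment> \<open>The value that \<open>real_count_bound\<close> returns for
    \<open>r = k - 1\<close>, \<open>a = 3 * 2 ^ k\<close> and \<open>b = 2 ^ k\<close>, the losses
    in \<open>card_blocks\<close>.\<close>
  define C where "C = real (k - 1) * (3 * 2 ^ k) + 2 ^ k"
  show "C \<ge> 0" by (simp add: C_def)
  fix m j :: nat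
  assume "m > 0" "j \<le> 1"
  then obtain K L :: "bit alg_closure set" where "char2_plane K L"
    and card_K: "card K = 2 ^ m" and card_L: "card L = 2 ^ (m - j)"
    using char2_plane_exists by blast
  interpret char2_plane K L by fact
  define M l where "M = card V" and "l = card L"
  have M: "M = card K * l" unfolding M_def l_def by (rule card_V)
  have "l > 0" by (simp add: l_def card_L)
  have count: "(real M - 3 * 2 ^ k * (real M / l)) ^ (k - 1) * (real l - 2 ^ k) \<le> fact (k + 1) * real (card (blocks k))"
    if "3 * 2 ^ k \<le> real l" "2 ^ k \<le> real l"
  proof -
    have q: "real M / l = real (card K)" using \<open>l > 0\<close> by (simp add: M)
    have "real (3 * 2 ^ k) \<le> real l" "real (2 ^ k) \<le> real l" using that by simp_all
    then have "3 * 2 ^ k \<le> l" and l2: "2 ^ k \<le> l" by (simp_all only: of_nat_le_iff)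
    then have l1: "3 * 2 ^ k * card K \<le> M" by (simp add: M mult.commute)
    have "real ((M - 3 * 2 ^ k * card K) ^ (k - 1) * (l - 2 ^ k)) \<le> real (fact (k + 1) * card (blocks k))"
      unfolding M_def l_def using card_blocks[OF assms] by (rule of_nat_mono)
    then show ?thesis
      unfolding q using l1 l2 by (simp add: of_nat_diff del: fact_Suc)
  qed
  have "real M ^ (k - 1) * real l - C * real M ^ (k - 1) \<le> fact (k + 1) * real (card (blocks k))"
    unfolding C_def by (rule real_count_bound) (use \<open>l > 0\<close> assms count in auto)
  also have "\<dots> \<le> fact (k + 1) * real (card (full_sets k V (block_edges k)))"
    using blocks_subset_full_sets[OF assms] finite_full_sets[OF finite_V]
    by (intro mult_left_mono of_nat_mono card_mono) auto
  finally have bound: "real M ^ (k - 1) * real l - C * real M ^ (k - 1)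
      \<le> fact (k + 1) * real (card (full_sets k V (block_edges k)))" .
  obtain f :: "bit alg_closure \<times> bit alg_closure \<Rightarrow> nat" where inj: "inj_on f V"
    using finite_V finite_imp_inj_to_nat_seg by blast
  define W where "W = f ` V"
  define E where "E = (`) f ` block_edges k"
  have card_W: "card W = M" unfolding W_def M_def by (rule card_image[OF inj])
  have "e \<subseteq> W \<and> card e = k" if "e \<in> E" for e
  proof -
    obtain e' where "e' \<in> block_edges k" "e = f ` e'" using \<open>e \<in> E\<close> by (auto simp: E_def)
    moreover from this have "e' \<subseteq> V" "card e' = k" using block_edgesD(1,2)[OF _ assms] by blast+
    ultimately show ?thesis
      using card_image[OF inj_on_subset[OF inj]] by (simp add: W_def image_mono)
  qed
  moreover have "\<not> suspended_C4 k E"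
    using suspended_C4_image[OF inj] block_edgesD(1)[OF _ assms] block_edges_suspended_C4_free[OF assms]
    unfolding E_def by blast
  moreover have "real M ^ (k - 1) * real l - C * real M ^ (k - 1) \<le> fact (k + 1) * real (card (full_sets k W E))"
    using card_full_sets_image[OF inj finite_V] unfolding W_def E_def
    by (intro order_trans[OF bound] mult_left_mono of_nat_mono) auto
  moreover have "finite W" using finite_V by (simp add: W_def)
  moreover have "real l = 2 ^ (m - j)" by (simp add: l_def card_L)
  ultimately show "\<exists>(V :: nat set) E. finite V \<and> card V = 2 ^ m * 2 ^ (m - j) \<and>
      (\<forall>e \<in> E. e \<subseteq> V \<and> card e = k) \<and> \<not> suspended_C4 k E \<and>
      real (card V) ^ (k - 1) * 2 ^ (m - j) - C * real (card V) ^ (k - 1)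
        \<le> fact (k + 1) * real (card (full_sets k V E))"
    using card_W by (intro exI[of _ W] exI[of _ E]) (simp add: M card_K l_def card_L)
qed

section \<open>Copies of cliques and of the suspended 4-cycle\<close>

lemma verts_suspension_C4:
  "verts (suspension k (cycle 4)) = Inl ` {..<k - 2} \<union> {Inr 0, Inr 1, Inr 2, Inr 3}"
proof -
  have "{..<4 :: nat} = {0, 1, 2, 3}" by auto
  then show ?thesis by (simp add: suspension_def cycle_def)
qed

lemma edges_suspension_C4:
  "edges (suspension k (cycle 4)) =
     {Inl ` {..<k - 2} \<union> {Inr 0, Inr 1}, Inl ` {..<k - 2} \<union> {Inr 1, Inr 2},
      Inl ` {..<k - 2} \<union> {Inr 2, Inr 3}, Inl ` {..<k - 2} \<union> {Inr 3, Inr 0}}"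
proof -
  have "{..<4 :: nat} = {0, 1, 2, 3}" by auto
  moreover have "Suc 0 mod 4 = 1" "Suc 1 mod 4 = 2" "Suc 2 mod 4 = 3" "Suc 3 mod 4 = 0" by simp_all
  ultimately show ?thesis
    by (simp only: suspension_def cycle_def hypergraph.sel image_insert image_empty)
qed

lemma free_of_suspension_C4_iff:
  assumes "hypergraph G"
  shows "free_of (suspension k (cycle 4)) G \<longleftrightarrow> \<not> suspended_C4 k (edges G)"
proof
  assume free: "free_of (suspension k (cycle 4)) G"
  show "\<not> suspended_C4 k (edges G)"
  proof
    assume "suspended_C4 k (edges G)"
    then obtain S x y z w where S: "finite S" "card S = k - 2" "distinct [x, y, z, w]" "S \<inter> {x, y, z, w} = {}"
      and E: "S \<union> {x, y} \<in> edges G" "S \<union> {y, z} \<in> edges G" "S \<union> {z, w} \<in> edges G" "S \<union> {w, x} \<in> edges G"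
      unfolding suspended_C4_def by metis
    obtain b where b: "bij_betw b {..<k - 2} S"
      using ex_bij_betw_nat_finite[OF S(1)] S(2) by (metis atLeast0LessThan)
    define h where "h = (\<lambda>i. if i = 0 then x else if i = 1 then y else if i = 2 then z else if i = (3 :: nat) then w else x)"
    have h: "h 0 = x" "h 1 = y" "h 2 = z" "h 3 = w" by (simp_all add: h_def)
    define f where "f = case_sum b h"
    define F where "F = Hypergraph (S \<union> {x, y, z, w}) {S \<union> {x, y}, S \<union> {y, z}, S \<union> {z, w}, S \<union> {w, x}}"
    have fI: "f ` (Inl ` {..<k - 2}) = S"
      using b by (simp add: f_def image_image bij_betw_def)
    have fr: "f (Inr i) = h i" for i by (simp add: f_def)
    have "bij_betw f (Inl ` {..<k - 2} \<union> {Inr 0, Inr 1, Inr 2, Inr 3}) (S \<union> {x, y, z, w})"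
    proof (rule bij_betw_combine)
      show "bij_betw f (Inl ` {..<k - 2}) S"
        using b fI by (auto simp: bij_betw_def inj_on_def f_def)
      show "bij_betw f {Inr 0, Inr 1, Inr 2, Inr 3} {x, y, z, w}"
        using S(3) h by (auto simp: bij_betw_def inj_on_def fr)
    qed (use S(4) in auto)
    moreover have "edges F = (`) f ` edges (suspension k (cycle 4))"
      by (simp only: F_def hypergraph.sel edges_suspension_C4 image_insert image_Un fI fr h image_empty)
    ultimately have "isomorphic (suspension k (cycle 4)) F"
      unfolding isomorphic_def verts_suspension_C4 F_def by auto
    moreover have "subhypergraph F G"
      using E S(1) assms unfolding subhypergraph_def hypergraph_def F_def by auto
    ultimately show False
      using free by (auto simp: free_of_def copies_def)
  qed
next
  assume no: "\<not> suspended_C4 k (edges G)"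
  show "free_of (suspension k (cycle 4)) G"
  proof (rule ccontr)
    assume "\<not> free_of (suspension k (cycle 4)) G"
    then obtain F f where F: "subhypergraph F G"
      "bij_betw f (verts (suspension k (cycle 4))) (verts F)"
      "edges F = (`) f ` edges (suspension k (cycle 4))"
      unfolding free_of_def copies_def isomorphic_def by blast
    define S where "S = f ` (Inl ` {..<k - 2})"
    have inj: "inj_on f (Inl ` {..<k - 2} \<union> {Inr 0, Inr 1, Inr 2, Inr 3})"
      using F(2) by (simp add: bij_betw_def verts_suspension_C4)
    have sub: "edges F \<subseteq> edges G"
      using F(1) by (simp add: subhypergraph_def)
    have edgs: "edges F = {S \<union> {f (Inr 0), f (Inr 1)}, S \<union> {f (Inr 1), f (Inr 2)},
        S \<union> {f (Inr 2), f (Inr 3)}, S \<union> {f (Inr 3), f (Inr 0)}}"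
      by (simp only: F(3) S_def edges_suspension_C4 image_insert image_Un image_empty)
    have "card S = card (Inl ` {..<k - 2} :: (nat + nat) set)"
      unfolding S_def by (rule card_image[OF inj_on_subset[OF inj Un_upper1]])
    also have "\<dots> = k - 2" by (simp add: card_image)
    finally have "card S = k - 2" .
    moreover have "finite S" by (simp add: S_def)
    moreover have "distinct [f (Inr 0), f (Inr 1), f (Inr 2), f (Inr 3)]"
      using inj_on_eq_iff[OF inj] by simp
    moreover have "S \<inter> {f (Inr 0), f (Inr 1), f (Inr 2), f (Inr 3)} = {}"
    proof -
      have "f ` (Inl ` {..<k - 2} \<inter> {Inr 0, Inr 1, Inr 2, Inr 3}) = S \<inter> f ` {Inr 0, Inr 1, Inr 2, Inr 3}"
        unfolding S_def by (rule inj_on_image_Int[OF inj Un_upper1 Un_upper2])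
      moreover have "(Inl ` {..<k - 2} \<inter> {Inr 0, Inr 1, Inr 2, Inr 3} :: (nat + nat) set) = {}" by auto
      ultimately show ?thesis by simp
    qed
    moreover have "S \<union> {f (Inr 0), f (Inr 1)} \<in> edges G" "S \<union> {f (Inr 1), f (Inr 2)} \<in> edges G"
      "S \<union> {f (Inr 2), f (Inr 3)} \<in> edges G" "S \<union> {f (Inr 3), f (Inr 0)} \<in> edges G"
      using sub unfolding edgs by auto
    ultimately show False
      using no unfolding suspended_C4_def by blast
  qed
qed

lemma image_nsubsets:
  assumes "bij_betw f A B"
  shows "(`) f ` {e. e \<subseteq> A \<and> card e = k} = {e. e \<subseteq> B \<and> card e = k}"
proof (rule Set.set_eqI, rule iffI)
  fix e assume "e \<in> (`) f ` {e. e \<subseteq> A \<and> card e = k}"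
  then obtain d where d: "d \<subseteq> A" "card d = k" "e = f ` d" by blast
  have "inj_on f d" using assms d(1) bij_betw_def inj_on_subset by metis
  then have "card e = k" using d(2,3) by (simp add: card_image)
  moreover have "e \<subseteq> B" using assms d(1,3) bij_betw_imp_surj_on image_mono by metis
  ultimately show "e \<in> {e. e \<subseteq> B \<and> card e = k}" by simp
next
  fix e assume e: "e \<in> {e. e \<subseteq> B \<and> card e = k}"
  define d where "d = A \<inter> f -` e"
  have surj: "f ` A = B" and inj: "inj_on f A" using assms by (auto simp: bij_betw_def)
  have "e = f ` d" using e surj by (auto simp: d_def)
  have "inj_on f d" by (rule inj_on_subset[OF inj]) (simp add: d_def)
  then have "card e = card d" unfolding \<open>e = f ` d\<close> by (rule card_image)
  then have "card d = k" using e by simp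
  then have "d \<in> {e. e \<subseteq> A \<and> card e = k}" by (simp add: d_def)
  then show "e \<in> (`) f ` {e. e \<subseteq> A \<and> card e = k}"
    unfolding \<open>e = f ` d\<close> by (rule imageI)
qed

text \<open>A bijection of vertex sets carries \<open>k\<close>-subsets onto
  \<open>k\<close>-subsets, so completeness and the number of vertices determine the isomorphism
  type.\<close>

lemma isomorphic_clique_iff:
  "isomorphic (clique k t) S \<and> finite (verts S) \<longleftrightarrow>
     finite (verts S) \<and> card (verts S) = t \<and> edges S = {e. e \<subseteq> verts S \<and> card e = k}"
proof (rule iffI)
  assume iso: "isomorphic (clique k t) S \<and> finite (verts S)"
  then obtain f where f: "bij_betw f {..<t} (verts S)"
      "edges S = (`) f ` {e. e \<subseteq> {..<t} \<and> card e = k}"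
    by (auto simp: isomorphic_def clique_def)
  then show "finite (verts S) \<and> card (verts S) = t \<and> edges S = {e. e \<subseteq> verts S \<and> card e = k}"
    using iso bij_betw_same_card[OF f(1)] image_nsubsets[OF f(1), of k] by simp
next
  assume S: "finite (verts S) \<and> card (verts S) = t \<and> edges S = {e. e \<subseteq> verts S \<and> card e = k}"
  then obtain f where f: "bij_betw f {..<t} (verts S)"
    using ex_bij_betw_nat_finite[of "verts S"] by (auto simp: atLeast0LessThan)
  moreover have "edges S = (`) f ` {e. e \<subseteq> {..<t} \<and> card e = k}"
    using S image_nsubsets[OF f, of k] by (simp only:)
  ultimately show "isomorphic (clique k t) S \<and> finite (verts S)"
    using S unfolding isomorphic_def clique_def hypergraph.sel by blast
qed

text \<open>A copy of a clique is determined by its vertex set; \<open>h\<close> rebuilds the copy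
  from it.\<close>

lemma card_copies_clique:
  assumes "hypergraph G"
  shows "card (copies (clique k (k + 1)) G) = card (full_sets k (verts G) (edges G))"
proof -
  define h where "h = (\<lambda>T :: 'a set. Hypergraph T {e. e \<subseteq> T \<and> card e = k})"
  have fin: "finite (verts G)" using assms by (simp add: hypergraph_def)
  have "inj_on h (full_sets k (verts G) (edges G))"
    by (auto simp: inj_on_def h_def)
  moreover have "h ` full_sets k (verts G) (edges G) = copies (clique k (k + 1)) G"
  proof (rule Set.set_eqI, rule iffI)
    fix S assume "S \<in> h ` full_sets k (verts G) (edges G)"
    then obtain T where T: "T \<in> full_sets k (verts G) (edges G)" "S = h T" by blast
    then have T': "T \<subseteq> verts G" "card T = k + 1" "{e. e \<subseteq> T \<and> card e = k} \<subseteq> edges G" "finite T"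
      using fin finite_subset by (auto simp: full_sets_def)
    then have "isomorphic (clique k (k + 1)) S"
      using isomorphic_clique_iff[of k "k + 1" S] T(2) by (simp add: h_def)
    moreover have "subhypergraph S G"
      using T' T(2) by (auto simp: subhypergraph_def hypergraph_def h_def)
    ultimately show "S \<in> copies (clique k (k + 1)) G" by (simp add: copies_def)
  next
    fix S assume "S \<in> copies (clique k (k + 1)) G"
    then have S: "subhypergraph S G" "isomorphic (clique k (k + 1)) S" by (simp_all add: copies_def)
    then have S': "finite (verts S)" "verts S \<subseteq> verts G" "edges S \<subseteq> edges G"
      by (simp_all add: subhypergraph_def hypergraph_def)
    then have S'': "card (verts S) = k + 1" "edges S = {e. e \<subseteq> verts S \<and> card e = k}"
      using isomorphic_clique_iff[of k "k + 1" S] S(2) by simp_all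
    then have "verts S \<in> full_sets k (verts G) (edges G)"
      using S' by (auto simp: full_sets_def)
    moreover have "S = h (verts S)"
      using S''(2) by (simp add: h_def hypergraph.expand)
    ultimately show "S \<in> h ` full_sets k (verts G) (edges G)" by blast
  qed
  ultimately show ?thesis by (metis card_image)
qed

section \<open>The upper bound\<close>

text \<open>Cauchy-Schwarz against the constant function 1, obtained from the nonnegative sum of
  squared deviations from the mean, scaled by \<open>n\<close>.\<close>

lemma sum_squared_le_card_mult:
  fixes f :: "'b \<Rightarrow> real"
  shows "(sum f A)\<^sup>2 \<le> real (card A) * (\<Sum>x\<in>A. (f x)\<^sup>2)"
proof -
  define n where "n = real (card A)"
  have "0 \<le> (\<Sum>x\<in>A. (n * f x - sum f A)\<^sup>2)"
    by (rule sum_nonneg) simp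
  also have "\<dots> = (\<Sum>x\<in>A. n\<^sup>2 * (f x)\<^sup>2 - 2 * n * sum f A * f x + (sum f A)\<^sup>2)"
    by (rule sum.cong) (simp_all add: power2_diff power_mult_distrib mult_ac)
  also have "\<dots> = n * (n * (\<Sum>x\<in>A. (f x)\<^sup>2) - (sum f A)\<^sup>2)"
    by (simp add: sum.distrib sum_subtractf n_def right_diff_distrib power2_eq_square
        flip: sum_distrib_left)
  finally have "0 \<le> n * (n * (\<Sum>x\<in>A. (f x)\<^sup>2) - (sum f A)\<^sup>2)" .
  moreover have "sum f A = 0" if "n = 0"
    using that by (cases "finite A") (auto simp: n_def)
  moreover have "n \<ge> 0" by (simp add: n_def)
  ultimately show ?thesis
    unfolding n_def[symmetric] by (cases "n = 0") (auto simp: zero_le_mult_iff)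
qed

text \<open>The Kovari-Sos-Turan argument for a bipartite relation: count the triples of a vertex
  and two of its neighbours, and compare with the squared number of pairs by Cauchy-Schwarz.\<close>

lemma C4_free_relation_bound:
  assumes "finite V" "R \<subseteq> V \<times> V"
    and C4: "\<And>x x' y y'. (x, y) \<in> R \<Longrightarrow> (x, y') \<in> R \<Longrightarrow> (x', y) \<in> R \<Longrightarrow> (x', y') \<in> R \<Longrightarrow> y \<noteq> y' \<Longrightarrow> x = x'"
  shows "real (card R) \<le> real (card V) * sqrt (card V) + card V"
proof -
  define d where "d = (\<lambda>x. R `` {x})"
  define n where "n = card V"
  have fin: "finite (d x)" for x
    by (rule finite_subset[OF _ assms(1)]) (use assms(2) in \<open>auto simp: d_def\<close>)
  have "R = Sigma V d"
    using assms(2) by (auto simp: d_def)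
  then have card_R: "card R = (\<Sum>x\<in>V. card (d x))"
    using assms(1) fin by (simp add: card_SigmaI)
  define P where "P = Sigma V (\<lambda>x. d x \<times> d x)"
  have card_P: "card P = (\<Sum>x\<in>V. card (d x) ^ 2)"
    using assms(1) fin by (simp add: P_def card_SigmaI card_cartesian_product power2_eq_square)
  \<comment> \<open>Triples with equal neighbours correspond to elements of \<open>R\<close>. For
    distinct neighbours \<open>C4\<close> allows only one common vertex, so there are at most
    \<open>card V\<close> squared of them.\<close>
  have "card {p \<in> P. fst (snd p) = snd (snd p)} \<le> card R"
  proof (rule card_inj_on_le)
    show "inj_on (\<lambda>p. (fst p, fst (snd p))) {p \<in> P. fst (snd p) = snd (snd p)}"
      by (auto simp: inj_on_def)
    show "(\<lambda>p. (fst p, fst (snd p))) ` {p \<in> P. fst (snd p) = snd (snd p)} \<subseteq> R"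
      by (auto simp: P_def d_def)
    show "finite R" using assms(1,2) finite_subset by blast
  qed
  moreover have "card {p \<in> P. fst (snd p) \<noteq> snd (snd p)} \<le> card (V \<times> V)"
  proof (rule card_inj_on_le)
    show "inj_on snd {p \<in> P. fst (snd p) \<noteq> snd (snd p)}"
      using C4 by (auto simp: inj_on_def P_def d_def)
    show "snd ` {p \<in> P. fst (snd p) \<noteq> snd (snd p)} \<subseteq> V \<times> V"
      using assms(2) by (auto simp: P_def d_def)
  qed (use assms(1) in simp)
  moreover have "card P = card {p \<in> P. fst (snd p) = snd (snd p)} + card {p \<in> P. fst (snd p) \<noteq> snd (snd p)}"
  proof -
    have "finite P" using assms(1) fin by (simp add: P_def)
    have "P = {p \<in> P. fst (snd p) = snd (snd p)} \<union> {p \<in> P. fst (snd p) \<noteq> snd (snd p)}" by blast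
    then have "card P = card ({p \<in> P. fst (snd p) = snd (snd p)} \<union> {p \<in> P. fst (snd p) \<noteq> snd (snd p)})"
      by (rule arg_cong)
    also have "\<dots> = card {p \<in> P. fst (snd p) = snd (snd p)} + card {p \<in> P. fst (snd p) \<noteq> snd (snd p)}"
      by (rule card_Un_disjoint) (use \<open>finite P\<close> in auto)
    finally show ?thesis .
  qed
  ultimately have "card P \<le> card R + n * n"
    by (simp add: n_def card_cartesian_product)
  then have P: "real (card P) \<le> card R + real n * n"
    by (simp flip: of_nat_add of_nat_mult)
  have "(\<Sum>x\<in>V. real (card (d x)))\<^sup>2 \<le> real n * (\<Sum>x\<in>V. (real (card (d x)))\<^sup>2)"
    unfolding n_def by (rule sum_squared_le_card_mult)
  then have "(real (card R))\<^sup>2 \<le> real (card P) * n"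
    by (simp add: card_R card_P mult.commute)
  also have "\<dots> \<le> (card R + real n * n) * n"
    using P by (rule mult_right_mono) simp
  finally have sq: "(real (card R))\<^sup>2 \<le> (card R + real n * n) * n" .
  define s where "s = sqrt n"
  have s: "s \<ge> 0" "real n = s * s" by (simp_all add: s_def)
  define D where "D = real (card R)"
  have "D \<le> s * s * s + s * s"
  \<comment> \<open>The inequality \<open>sq\<close> reads \<open>D (D - s^2) \<le> s^6\<close>. It
    fails beyond \<open>s^3 + s^2\<close>, where \<open>D - s^2\<close> and \<open>D\<close> both
    exceed \<open>s^3\<close>.\<close>
  proof (rule ccontr)
    assume "\<not> D \<le> s * s * s + s * s"
    then have less: "s * s * s + s * s < D" by simp
    have "(s * s * s) * (s * s * s) \<le> (s * s * s + s * s) * (s * s * s)"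
      using s(1) by (intro mult_right_mono) auto
    also have "\<dots> \<le> D * (s * s * s)"
      using less s(1) by (intro mult_right_mono) auto
    also have "\<dots> \<le> D * (D - s * s)"
      using less by (intro mult_left_mono) (auto simp: D_def)
    finally have le: "(s * s * s) * (s * s * s) \<le> D * (D - s * s)" .
    have "D * (D - s * s) \<le> (s * s * s) * (s * s * s)"
      using sq unfolding s(2) D_def[symmetric] by (simp add: algebra_simps power2_eq_square)
    with le have eq: "D * (D - s * s) = (s * s * s) * (s * s * s)" by simp
    have "D > 0" using less s(1) by (smt (verit) mult_nonneg_nonneg)
    then have "D * (s * s * s) < D * (D - s * s)"
      using less by (intro mult_strict_left_mono) auto
    moreover have "(s * s * s) * (s * s * s) \<le> D * (s * s * s)"
      using less s(1) by (intro mult_right_mono) (smt (verit) mult_nonneg_nonneg, simp)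
    ultimately show False using eq by linarith
  qed
  moreover have "real n * sqrt n + real n = s * s * s + s * s"
    unfolding s_def[symmetric] by (simp only: s(2))
  ultimately show ?thesis by (simp add: D_def n_def)
qed

lemma suspended_C4I:
  assumes "finite S" "card S = k - 2" "distinct [x, y, z, w]" "S \<inter> {x, y, z, w} = {}"
    and "S \<union> {x, y} \<in> E" "S \<union> {y, z} \<in> E" "S \<union> {z, w} \<in> E" "S \<union> {w, x} \<in> E"
  shows "suspended_C4 k E"
  unfolding suspended_C4_def using assms by blast

context
  fixes k :: nat and V :: "'b set" and E :: "'b set set"
  assumes k: "k \<ge> 2" and fin: "finite V" and unif: "\<And>e. e \<in> E \<Longrightarrow> e \<subseteq> V \<and> card e = k"
    and free: "\<not> suspended_C4 k E"
begin

lemma finite_E: "finite E"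
  by (rule finite_subset[of _ "Pow V"]) (use unif fin in auto)

text \<open>If \<open>a, u\<close> belong to the common edge of two cliques with apexes \<open>x \<noteq> x'\<close>, then \<open>a, x, u, x'\<close>
  is a suspended 4-cycle.\<close>

lemma full_sets_edge_unique:
  assumes T: "T \<in> full_sets k V E" "T' \<in> full_sets k V E"
    and x: "x \<in> T" "x' \<in> T'" and eq: "T - {x} = T' - {x'}"
  shows "x = x'"
proof (rule ccontr)
  assume ne: "x \<noteq> x'"
  have T1: "T \<subseteq> V" "card T = k + 1" "\<And>e. e \<subseteq> T \<Longrightarrow> card e = k \<Longrightarrow> e \<in> E"
    using T(1) unfolding full_sets_def by blast+
  have T2: "\<And>e. e \<subseteq> T' \<Longrightarrow> card e = k \<Longrightarrow> e \<in> E"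
    using T(2) unfolding full_sets_def by blast+
  define e where "e = T - {x}"
  have fin_e: "finite e" using T1(1) fin finite_subset unfolding e_def by blast
  have card_e: "card e = k"
    using T1(1,2) x(1) fin finite_subset unfolding e_def by (subst card_Diff_singleton) auto
  obtain a where a: "a \<in> e" using card_e k by fastforce
  have "card (e - {a}) = k - 1" using a card_e fin_e by simp
  then have "card (e - {a}) \<noteq> 0" using k by simp
  then have "e - {a} \<noteq> {}" by (metis card.empty)
  then obtain u where u: "u \<in> e - {a}" by blast
  define S where "S = e - {a, u}"
  have S: "finite S" "card S = k - 2" "a \<notin> S" "u \<notin> S"
    using a u card_e fin_e by (auto simp: S_def card_Diff_subset card_insert_if numeral_2_eq_2)
  have "x \<notin> e" by (simp add: e_def)
  moreover have "x' \<notin> e" unfolding e_def eq by simp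
  ultimately have out: "x \<notin> e" "x' \<notin> e" .
  have dist: "distinct [a, x, u, x']" "S \<inter> {a, x, u, x'} = {}"
    using out a u ne by (auto simp: S_def)
  have "insert x e \<subseteq> T" using x(1) by (auto simp: e_def)
  moreover have "insert x' e \<subseteq> T'" unfolding e_def eq using x(2) by auto
  ultimately have sub: "insert x e \<subseteq> T" "insert x' e \<subseteq> T'" .
  have card2: "card (S \<union> {p, q}) = k" if "p \<notin> S" "q \<notin> S" "p \<noteq> q" for p q
    using that S(1,2) k by simp
  have Ssub: "S \<subseteq> e" "a \<in> e" "u \<in> e" using a u by (auto simp: S_def)
  have "suspended_C4 k E"
  proof (rule suspended_C4I[OF S(1,2) dist])
    show "S \<union> {a, x} \<in> E"
      by (rule T1(3)[OF _ card2]) (use sub Ssub S dist in auto)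
    show "S \<union> {x, u} \<in> E"
      by (rule T1(3)[OF _ card2]) (use sub Ssub S dist in auto)
    show "S \<union> {u, x'} \<in> E"
      by (rule T2[OF _ card2]) (use sub Ssub S dist in auto)
    show "S \<union> {x', a} \<in> E"
      by (rule T2[OF _ card2]) (use sub Ssub S dist in auto)
  qed
  with free show False ..
qed

lemma card_full_sets_le_edges: "(k + 1) * card (full_sets k V E) \<le> card E"
proof -
  let ?F = "full_sets k V E"
  have finF: "finite ?F" by (rule finite_full_sets[OF fin])
  have finT: "finite T" if "T \<in> ?F" for T
    using that finite_subset[OF _ fin] by (simp add: full_sets_def)
  have "card (Sigma ?F (\<lambda>T. T)) \<le> card E"
  proof (rule card_inj_on_le)
    show "inj_on (\<lambda>(T, x). T - {x}) (Sigma ?F (\<lambda>T. T))"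
    proof (rule inj_onI, clarify)
      fix T x T' x' assume *: "T \<in> ?F" "x \<in> T" "T' \<in> ?F" "x' \<in> T'" "T - {x} = T' - {x'}"
      then have xx': "x = x'" using full_sets_edge_unique by blast
      have "T = insert x (T - {x})" using *(2) by auto
      also have "\<dots> = insert x' (T' - {x'})" unfolding *(5) unfolding xx' ..
      also have "\<dots> = T'" using *(4) by auto
      finally show "T = T' \<and> x = x'" using xx' by simp
    qed
    show "(\<lambda>(T, x). T - {x}) ` Sigma ?F (\<lambda>T. T) \<subseteq> E"
    proof clarify
      fix T x assume "T \<in> ?F" "x \<in> T"
      then show "T - {x} \<in> E"
        using finT[of T] by (simp add: full_sets_def)
    qed
  qed (rule finite_E)
  moreover have "card (Sigma ?F (\<lambda>T. T)) = (\<Sum>T\<in>?F. card T)"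
    using finF finT by (simp add: card_SigmaI)
  moreover have "\<dots> = (\<Sum>T\<in>?F. k + 1)"
    by (rule sum.cong) (auto simp: full_sets_def)
  ultimately show ?thesis by (simp add: mult.commute)
qed

text \<open>Each edge has \<open>k (k - 1)\<close> ordered pairs of vertices, and removing a pair
  leaves a \<open>(k - 2)\<close>-set \<open>S\<close>. The triples \<open>(e, x, y)\<close> are
  thus counted by the symmetric link relations \<open>R S\<close>, each of them free of
  4-cycles.\<close>

lemma card_edges_bound:
  "real (k * (k - 1) * card E) \<le> real (card V choose (k - 2)) * (card V * sqrt (card V) + card V)"
proof -
  define N where "N = {S. S \<subseteq> V \<and> card S = k - 2}"
  define R where "R = (\<lambda>S. {(x, y). x \<in> V - S \<and> y \<in> V - S \<and> x \<noteq> y \<and> S \<union> {x, y} \<in> E})"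
  define F where "F = Sigma E (\<lambda>e. Sigma e (\<lambda>x. e - {x}))"
  have finN: "finite N" by (rule finite_subset[of _ "Pow V"]) (use fin in \<open>auto simp: N_def\<close>)
  have finR: "finite (R S)" for S
    by (rule finite_subset[of _ "V \<times> V"]) (use fin in \<open>auto simp: R_def\<close>)
  have fine: "finite e" if "e \<in> E" for e using unif[OF that] finite_subset[OF _ fin] by simp
  have "card (Sigma e (\<lambda>x. e - {x})) = k * (k - 1)" if "e \<in> E" for e
    using fine[OF that] unif that by (simp add: card_SigmaI)
  then have "card F = (\<Sum>e\<in>E. k * (k - 1))"
    unfolding F_def using finite_E fine by (subst card_SigmaI) auto
  then have card_F: "card F = k * (k - 1) * card E" by simp
  have "card F \<le> card (Sigma N R)"
  proof (rule card_inj_on_le)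
    show "inj_on (\<lambda>(e, x, y). (e - {x, y}, x, y)) F"
    proof (rule inj_onI)
      fix p p' assume *: "p \<in> F" "p' \<in> F"
        "(\<lambda>(e, x, y). (e - {x, y}, x, y)) p = (\<lambda>(e, x, y). (e - {x, y}, x, y)) p'"
      obtain e x y e' x' y' where p: "p = (e, x, y)" "p' = (e', x', y')" by (metis prod_cases3)
      have "e - {x, y} = e' - {x', y'} \<and> x = x' \<and> y = y'"
        using *(3) unfolding p prod.case prod.inject .
      then have eq: "e - {x, y} = e' - {x, y}" and xy: "x' = x" "y' = y" by blast+
      have "e = (e - {x, y}) \<union> {x, y}" using *(1) by (auto simp: F_def p)
      also have "\<dots> = e'" unfolding eq using *(2) xy by (auto simp: F_def p)
      finally show "p = p'" using xy p by simp
    qed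
    show "(\<lambda>(e, x, y). (e - {x, y}, x, y)) ` F \<subseteq> Sigma N R"
    proof (rule image_subsetI)
      fix p assume "p \<in> F"
      moreover obtain e x y where p: "p = (e, x, y)" by (rule prod_cases3)
      ultimately have e: "e \<in> E" "x \<in> e" "y \<in> e" "x \<noteq> y" by (auto simp: F_def)
      then have "e \<subseteq> V" "card e = k" using unif by auto
      moreover have "card (e - {x, y}) = k - 2"
        using e fine[OF e(1)] \<open>card e = k\<close> by (auto simp: card_Diff_subset card_insert_if numeral_2_eq_2)
      moreover have "e - {x, y} \<union> {x, y} = e" using e by auto
      ultimately show "(case p of (e, x, y) \<Rightarrow> (e - {x, y}, x, y)) \<in> Sigma N R"
        using e unfolding p prod.case by (auto simp: N_def R_def)
    qed
    show "finite (Sigma N R)" using finN finR by simp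
  qed
  then have "real (card F) \<le> (\<Sum>S\<in>N. real (card (R S)))"
    using finN finR by (simp add: card_SigmaI flip: of_nat_sum)
  also have "\<dots> \<le> (\<Sum>S\<in>N. real (card V) * sqrt (card V) + card V)"
  proof (rule sum_mono)
    fix S assume S: "S \<in> N"
    show "real (card (R S)) \<le> card V * sqrt (card V) + card V"
    proof (rule C4_free_relation_bound[OF fin])
      show "R S \<subseteq> V \<times> V" by (auto simp: R_def)
      fix x x' y y' assume *: "(x, y) \<in> R S" "(x, y') \<in> R S" "(x', y) \<in> R S" "(x', y') \<in> R S" "y \<noteq> y'"
      show "x = x'"
      proof (rule ccontr)
        assume "x \<noteq> x'"
        have "suspended_C4 k E"
        proof (rule suspended_C4I)
          show "finite S" using S fin finite_subset by (auto simp: N_def)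
          show "card S = k - 2" using S by (simp add: N_def)
          show "distinct [x, y, x', y']" using * \<open>x \<noteq> x'\<close> by (auto simp: R_def)
          show "S \<inter> {x, y, x', y'} = {}" using * by (auto simp: R_def)
          show "S \<union> {x, y} \<in> E" "S \<union> {y, x'} \<in> E" "S \<union> {x', y'} \<in> E" "S \<union> {y', x} \<in> E"
            using * by (simp_all add: R_def insert_commute)
        qed
        with free show False ..
      qed
    qed
  qed
  also have "\<dots> = real (card N) * (card V * sqrt (card V) + card V)" by simp
  also have "card N = card V choose (k - 2)"
    unfolding N_def by (rule n_subsets[OF fin])
  finally show ?thesis unfolding card_F .
qed

text \<open>The constant \<open>(k + 1)!\<close> assembles from \<open>k + 1\<close> edges per
  clique, \<open>k (k - 1)\<close> ordered pairs per edge and \<open>(k - 2)!\<close> from bounding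
  the number of sets \<open>S\<close> by a power of \<open>n\<close>.\<close>

lemma full_sets_upper_bound:
  "fact (k + 1) * real (card (full_sets k V E)) \<le> real (card V) ^ (k - 1) * sqrt (card V) + real (card V) ^ (k - 1)"
proof -
  define n where "n = card V"
  have k': "k = Suc (Suc (k - 2))" using k by simp
  have fact_k: "fact k = (fact (k - 2) * real (k * (k - 1)))"
    by (subst k', subst fact_Suc, subst fact_Suc) (use k in \<open>simp add: of_nat_diff\<close>)
  have "fact (k + 1) * real (card (full_sets k V E)) = fact k * real ((k + 1) * card (full_sets k V E))"
    by (simp add: algebra_simps)
  also have "\<dots> \<le> fact k * real (card E)"
    using card_full_sets_le_edges by (intro mult_left_mono of_nat_mono) auto
  also have "\<dots> = fact (k - 2) * real (k * (k - 1) * card E)"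
    unfolding fact_k by simp
  also have "\<dots> \<le> fact (k - 2) * (real (n choose (k - 2)) * (n * sqrt n + n))"
    using card_edges_bound unfolding n_def by (intro mult_left_mono) auto
  also have "\<dots> = real ((n choose (k - 2)) * fact (k - 2)) * (n * sqrt n + n)"
    by simp
  also have "\<dots> \<le> real (n ^ (k - 2)) * (n * sqrt n + n)"
    by (intro mult_right_mono of_nat_mono binomial_fact_pow) auto
  also have "\<dots> = real n ^ (k - 1) * sqrt n + real n ^ (k - 1)"
  proof -
    have "k - 1 = Suc (k - 2)" using k by simp
    then show ?thesis by (simp add: algebra_simps)
  qed
  finally show ?thesis unfolding n_def .
qed

end

section \<open>The extremal number\<close>

definition admissible_counts :: "nat \<Rightarrow> nat \<Rightarrow> nat set" where
  "admissible_counts k n = {card (copies (clique k (k + 1)) G) | G :: nat hypergraph.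
     uniform k G \<and> card (verts G) = n \<and> free_of (suspension k (cycle 4)) G}"

lemma ex_eq_Max: "ex k n (clique k (k + 1)) (suspension k (cycle 4)) = Max (admissible_counts k n)"
  unfolding ex_def admissible_counts_def ..

lemma admissible_counts_upper:
  assumes "k \<ge> 2" "c \<in> admissible_counts k n"
  shows "fact (k + 1) * real c \<le> real n ^ (k - 1) * sqrt n + real n ^ (k - 1)"
proof -
  obtain G :: "nat hypergraph" where G: "c = card (copies (clique k (k + 1)) G)" "uniform k G" "card (verts G) = n"
    "free_of (suspension k (cycle 4)) G"
    using assms(2) unfolding admissible_counts_def by blast
  then have hyp: "hypergraph G" and unif: "\<And>e. e \<in> edges G \<Longrightarrow> e \<subseteq> verts G \<and> card e = k"
    by (auto simp: uniform_def hypergraph_def)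
  have "finite (verts G)" using hyp by (simp add: hypergraph_def)
  from full_sets_upper_bound[OF assms(1) this unif]
  show ?thesis
    using G(3,4) free_of_suspension_C4_iff[OF hyp] by (simp only: G(1) card_copies_clique[OF hyp])
qed

text \<open>The upper bound confines the counts to an initial segment, which makes the
  \<open>Max\<close> in \<open>ex\<close> a genuine maximum.\<close>

lemma admissible_counts_finite:
  assumes "k \<ge> 2"
  shows "finite (admissible_counts k n)"
proof (rule finite_subset)
  define U where "U = real n ^ (k - 1) * sqrt n + real n ^ (k - 1)"
  show "admissible_counts k n \<subseteq> {..nat \<lfloor>U\<rfloor>}"
  proof
    fix c assume "c \<in> admissible_counts k n"
    from admissible_counts_upper[OF assms this] have "fact (k + 1) * real c \<le> U"
      by (simp only: U_def)
    moreover have "1 * real c \<le> fact (k + 1) * real c"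
      by (intro mult_right_mono fact_ge_1) simp
    ultimately have "real c \<le> U" by linarith
    then show "c \<in> {..nat \<lfloor>U\<rfloor>}" by (simp add: le_nat_floor)
  qed
qed simp

lemma admissible_counts_mem:
  fixes V :: "nat set"
  assumes "finite V" "card V = n" "\<And>e. e \<in> E \<Longrightarrow> e \<subseteq> V \<and> card e = k" "\<not> suspended_C4 k E"
  shows "card (full_sets k V E) \<in> admissible_counts k n"
proof -
  define G where "G = Hypergraph V E"
  have hyp: "hypergraph G" and unif: "uniform k G"
    using assms by (auto simp: G_def hypergraph_def uniform_def)
  have "free_of (suspension k (cycle 4)) G"
    using free_of_suspension_C4_iff[OF hyp] assms(4) by (simp add: G_def)
  moreover have "card (copies (clique k (k + 1)) G) = card (full_sets k V E)"
    using card_copies_clique[OF hyp] by (simp add: G_def)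
  moreover have "card (verts G) = n" using assms(2) by (simp add: G_def)
  ultimately show ?thesis
    unfolding admissible_counts_def using unif by (intro CollectI exI[of _ G] conjI) simp_all
qed

lemma ex_upper:
  assumes "k \<ge> 2"
  shows "fact (k + 1) * real (ex k n (clique k (k + 1)) (suspension k (cycle 4)))
    \<le> real n ^ (k - 1) * sqrt n + real n ^ (k - 1)"
proof -
  \<comment> \<open>The edgeless hypergraph witnesses that the set of counts is nonempty.\<close>
  have "card (full_sets k {..<n} {}) \<in> admissible_counts k n"
    by (rule admissible_counts_mem) (auto simp: suspended_C4_def)
  then have "Max (admissible_counts k n) \<in> admissible_counts k n"
    using admissible_counts_finite[OF assms] by (intro Max_in) auto
  then show ?thesis
    unfolding ex_eq_Max by (rule admissible_counts_upper[OF assms])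
qed

lemma ex_ge:
  fixes V :: "nat set"
  assumes "k \<ge> 2" "finite V" "card V = n" "\<And>e. e \<in> E \<Longrightarrow> e \<subseteq> V \<and> card e = k" "\<not> suspended_C4 k E"
  shows "card (full_sets k V E) \<le> ex k n (clique k (k + 1)) (suspension k (cycle 4))"
  unfolding ex_eq_Max
  by (rule Max_ge[OF admissible_counts_finite[OF assms(1)] admissible_counts_mem[OF assms(2-5)]])

lemma ex_ge_superset:
  fixes V :: "nat set"
  assumes "k \<ge> 2" "finite V" "card V \<le> n" "\<And>e. e \<in> E \<Longrightarrow> e \<subseteq> V \<and> card e = k" "\<not> suspended_C4 k E"
  shows "card (full_sets k V E) \<le> ex k n (clique k (k + 1)) (suspension k (cycle 4))"
proof -
  have "infinite (- V)" using assms(2) by simp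
  then obtain A where A: "finite A" "card A = n - card V" "A \<subseteq> - V"
    using infinite_arbitrarily_large by blast
  define W where "W = V \<union> A"
  have "finite W" using A(1) assms(2) by (simp add: W_def)
  have "card W = n"
    using A assms(2,3) unfolding W_def by (subst card_Un_disjoint) auto
  have "full_sets k V E \<subseteq> full_sets k W E" by (auto simp: full_sets_def W_def)
  then have "card (full_sets k V E) \<le> card (full_sets k W E)"
    by (rule card_mono[OF finite_full_sets[OF \<open>finite W\<close>]])
  also have "\<dots> \<le> ex k n (clique k (k + 1)) (suspension k (cycle 4))"
    by (rule ex_ge[OF assms(1) \<open>finite W\<close> \<open>card W = n\<close> _ assms(5)]) (use assms(4) in \<open>auto simp: W_def\<close>)
  finally show ?thesis .
qed

section \<open>Sampling the vertex set\<close>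

lemma suspended_C4_mono: "suspended_C4 k E \<Longrightarrow> E \<subseteq> F \<Longrightarrow> suspended_C4 k F"
  unfolding suspended_C4_def by (meson subsetD)

lemma card_supersets:
  assumes "finite V" "T \<subseteq> V" "card T \<le> n"
  shows "card {U. U \<subseteq> V \<and> card U = n \<and> T \<subseteq> U} = (card V - card T) choose (n - card T)"
proof -
  have finT: "finite T" using assms(1,2) by (rule rev_finite_subset)
  have "bij_betw (\<lambda>W. W \<union> T) {W. W \<subseteq> V - T \<and> card W = n - card T} {U. U \<subseteq> V \<and> card U = n \<and> T \<subseteq> U}"
  proof (rule bij_betwI[where g = "\<lambda>U. U - T"])
    show "(\<lambda>W. W \<union> T) \<in> {W. W \<subseteq> V - T \<and> card W = n - card T} \<rightarrow> {U. U \<subseteq> V \<and> card U = n \<and> T \<subseteq> U}"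
    proof (rule funcsetI)
      fix W assume W: "W \<in> {W. W \<subseteq> V - T \<and> card W = n - card T}"
      then have "finite W" using finite_subset[of W "V - T"] assms(1) by simp
      then have "card (W \<union> T) = card W + card T"
        using W finT by (intro card_Un_disjoint) auto
      then show "W \<union> T \<in> {U. U \<subseteq> V \<and> card U = n \<and> T \<subseteq> U}"
        using W assms(2,3) by auto
    qed
    show "(\<lambda>U. U - T) \<in> {U. U \<subseteq> V \<and> card U = n \<and> T \<subseteq> U} \<rightarrow> {W. W \<subseteq> V - T \<and> card W = n - card T}"
      using finT by (auto simp: card_Diff_subset)
  qed auto
  then have "card {U. U \<subseteq> V \<and> card U = n \<and> T \<subseteq> U} = card {W. W \<subseteq> V - T \<and> card W = n - card T}"
    by (rule bij_betw_same_card[symmetric])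
  also have "\<dots> = card (V - T) choose (n - card T)"
    using assms(1) by (intro n_subsets) simp
  also have "card (V - T) = card V - card T"
    using finT assms(2) by (rule card_Diff_subset)
  finally show ?thesis .
qed

text \<open>Double counting of cliques inside \<open>n\<close>-subsets, with denominators cleared: a
  random \<open>n\<close>-subset contains each clique with probability
  \<open>(n choose (k + 1)) / (card V choose (k + 1))\<close>, and no \<open>n\<close>-subset
  contains more than \<open>ex\<close> of them.\<close>

lemma ex_ge_subset:
  fixes V :: "nat set"
  assumes "k \<ge> 2" "finite V" "n \<le> card V" "\<And>e. e \<in> E \<Longrightarrow> e \<subseteq> V \<and> card e = k" "\<not> suspended_C4 k E"
  shows "card (full_sets k V E) * (n choose (k + 1))
    \<le> ex k n (clique k (k + 1)) (suspension k (cycle 4)) * (card V choose (k + 1))"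
proof (cases "k + 1 \<le> n")
  case False
  then show ?thesis by (simp add: binomial_eq_0)
next
  case True
  define x where "x = ex k n (clique k (k + 1)) (suspension k (cycle 4))"
  define M where "M = card V"
  define F where "F = full_sets k V E"
  define N where "N = {U. U \<subseteq> V \<and> card U = n}"
  have finN: "finite N" by (rule finite_subset[of _ "Pow V"]) (use assms(2) in \<open>auto simp: N_def\<close>)
  have finF: "finite F" unfolding F_def by (rule finite_full_sets[OF assms(2)])
  have "card {T \<in> F. T \<subseteq> U} \<le> x" if U: "U \<in> N" for U
  proof -
    have "finite U" "card U = n" using U finite_subset[OF _ assms(2)] by (auto simp: N_def)
    have "{T \<in> F. T \<subseteq> U} \<subseteq> full_sets k U (E \<inter> Pow U)"
      by (auto simp: F_def full_sets_def)
    then have "card {T \<in> F. T \<subseteq> U} \<le> card (full_sets k U (E \<inter> Pow U))"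
      by (rule card_mono[OF finite_full_sets[OF \<open>finite U\<close>]])
    also have "\<dots> \<le> x"
      unfolding x_def
    proof (rule ex_ge[OF assms(1) \<open>finite U\<close> \<open>card U = n\<close>])
      show "\<not> suspended_C4 k (E \<inter> Pow U)" using suspended_C4_mono assms(5) by blast
    qed (use assms(4) in auto)
    finally show ?thesis .
  qed
  then have "(\<Sum>U\<in>N. card {T \<in> F. T \<subseteq> U}) \<le> (\<Sum>U\<in>N. x)" by (rule sum_mono)
  also have "\<dots> = (M choose n) * x"
    by (simp add: N_def M_def n_subsets[OF assms(2)])
  also have "(\<Sum>U\<in>N. card {T \<in> F. T \<subseteq> U}) = (\<Sum>T\<in>F. card {U \<in> N. T \<subseteq> U})"
    unfolding card_eq_sum by (rule sum.swap_restrict[OF finN finF])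
  finally have le: "(\<Sum>T\<in>F. card {U \<in> N. T \<subseteq> U}) \<le> (M choose n) * x" .
  have "(\<Sum>T\<in>F. card {U \<in> N. T \<subseteq> U}) = (\<Sum>T\<in>F. (M - (k + 1)) choose (n - (k + 1)))"
  proof (rule sum.cong[OF refl])
    fix T assume "T \<in> F"
    then have "T \<subseteq> V" "card T = k + 1" by (auto simp: F_def full_sets_def)
    then have "card {U. U \<subseteq> V \<and> card U = n \<and> T \<subseteq> U} = (M - (k + 1)) choose (n - (k + 1))"
      using card_supersets[OF assms(2) \<open>T \<subseteq> V\<close>] True by (simp add: M_def)
    then show "card {U \<in> N. T \<subseteq> U} = (M - (k + 1)) choose (n - (k + 1))"
      by (simp add: N_def conj_assoc)
  qed
  then have "card F * ((M - (k + 1)) choose (n - (k + 1))) \<le> (M choose n) * x"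
    using le by simp
  then have "card F * ((M - (k + 1)) choose (n - (k + 1))) * (M choose (k + 1)) \<le> (M choose n) * x * (M choose (k + 1))"
    by (rule mult_le_mono1)
  moreover have "(M choose n) * (n choose (k + 1)) = (M choose (k + 1)) * ((M - (k + 1)) choose (n - (k + 1)))"
    using True assms(3) unfolding M_def by (rule choose_mult)
  ultimately have "(M choose n) * (card F * (n choose (k + 1))) \<le> (M choose n) * (x * (M choose (k + 1)))"
    by (metis (no_types, lifting) mult.assoc mult.commute mult.left_commute)
  moreover have "M choose n > 0" using assms(3) by (simp add: M_def)
  ultimately show ?thesis
    unfolding F_def M_def x_def by simp
qed

text \<open>Every factor of the falling factorial is at least \<open>n - r\<close>, and Bernoulli's
  inequality expands \<open>(n - r) ^ Suc r\<close>.\<close>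

lemma fact_choose_lower:
  "real n ^ Suc r - real (r * Suc r) * real n ^ r \<le> fact (Suc r) * real (n choose Suc r)"
proof (cases "r < n")
  case False
  then have "real n * real n ^ r \<le> real (r * Suc r) * real n ^ r"
    by (intro mult_right_mono) (auto simp flip: of_nat_mult simp: le_Suc_eq intro: order_trans)
  then have "real n ^ Suc r - real (r * Suc r) * real n ^ r \<le> 0" by simp
  also have "0 \<le> fact (Suc r) * real (n choose Suc r)" by simp
  finally show ?thesis .
next
  case True
  have "real n > 0" using True by simp
  have "1 + real (Suc r) * (- (real r / n)) \<le> (1 + - (real r / n)) ^ Suc r"
    using True by (intro Bernoulli_inequality) simp
  then have "real n ^ Suc r * (1 + real (Suc r) * (- (real r / n))) \<le> real n ^ Suc r * (1 + - (real r / n)) ^ Suc r"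
    by (rule mult_left_mono) simp
  also have "\<dots> = (real n * (1 + - (real r / n))) ^ Suc r"
    by (simp only: power_mult_distrib)
  also have "\<dots> = (\<Prod>i<Suc r. real n - real r)"
    using \<open>real n > 0\<close> by (simp add: algebra_simps)
  also have "\<dots> \<le> (\<Prod>i<Suc r. real n - real i)"
    using True by (intro prod_mono) auto
  also have "\<dots> = fact (Suc r) * real (n choose Suc r)"
    using gbinomial_mult_fact[of "Suc r" "real n"] by (simp only: binomial_gbinomial atLeast0LessThan)
  finally have "real n ^ Suc r * (1 + real (Suc r) * (- (real r / n))) \<le> fact (Suc r) * real (n choose Suc r)" .
  moreover have "real n ^ Suc r * (1 + real (Suc r) * (- (real r / n))) = real n ^ Suc r - real (r * Suc r) * real n ^ r"
    using \<open>real n > 0\<close> by (simp add: field_simps)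
  ultimately show ?thesis by simp
qed

text \<open>Here \<open>i = k - 2\<close>, while \<open>F\<close> and \<open>Y\<close> are the
  clique count of the large construction and the extremal number, both times
  \<open>(k + 1)!\<close>. Sampling multiplies \<open>M^(k-1) l\<close> by
  \<open>(n / M)^(k+1)\<close>, leaving \<open>n^(k+1) l / M^2\<close>. Since \<open>n\<close> and
  \<open>l\<close> are at most \<open>M\<close>, both errors shrink to order
  \<open>n^(k-1)\<close>.\<close>

lemma scaled_count_bound:
  fixes n M l C c F Y :: real
  assumes n: "n > 0" "n \<le> M" and l: "0 \<le> l" "l \<le> M" and "C \<ge> 0" "c \<ge> 0" "F \<ge> 0" "Y \<ge> 0"
    and F: "M ^ Suc i * l - C * M ^ Suc i \<le> F"
    and Y: "F * (n ^ (i + 3) - c * n ^ (i + 2)) \<le> Y * M ^ (i + 3)"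
  shows "n ^ (i + 3) * l / M\<^sup>2 - (C + c) * n ^ Suc i \<le> Y"
proof -
  have "M > 0" using n by linarith
  have e3: "n ^ (i + 3) = n ^ Suc i * (n * n)" and e2: "n ^ (i + 2) = n ^ Suc i * n"
    and M3: "M ^ (i + 3) = M ^ Suc i * (M * M)"
    by (simp_all add: power_add power2_eq_square power3_eq_cube)
  have nn: "n * n \<le> M * M" using n by (intro mult_mono) auto
  have nl: "n * l \<le> M * M" using n l by (intro mult_mono) auto
  show ?thesis
  proof (cases "n \<le> c")
    \<comment> \<open>For \<open>n \<le> c\<close> the main term is itself at most
      \<open>c * n ^ Suc i\<close>, so the left-hand side is not positive; otherwise the factor
      \<open>n - c\<close> is positive and the lower bound for \<open>F\<close> can be multiplied by
      it.\<close>
    case True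
    have "n * n * l \<le> c * (M * M)"
      using mult_mono[OF True nl] n l assms(6) by (simp add: mult.assoc)
    then have "n * n * l / (M * M) \<le> c" using \<open>M > 0\<close> by (simp add: divide_le_eq)
    then have "n ^ Suc i * (n * n * l / (M * M)) \<le> n ^ Suc i * (C + c)"
      using n assms(5) by (intro mult_left_mono) auto
    then have "n ^ (i + 3) * l / M\<^sup>2 - (C + c) * n ^ Suc i \<le> 0"
      unfolding e3 power2_eq_square by (simp add: mult_ac)
    then show ?thesis using assms(8) by linarith
  next
    case False
    define Z where "Z = n ^ Suc i * n * (n - c)"
    have Z: "Z \<ge> 0" unfolding Z_def using False n by (intro mult_nonneg_nonneg) auto
    have "M ^ Suc i * ((l - C) * Z) = (M ^ Suc i * l - C * M ^ Suc i) * Z"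
      by (simp add: algebra_simps)
    also have "\<dots> \<le> F * Z" using F Z by (rule mult_right_mono)
    also have "\<dots> = F * (n ^ (i + 3) - c * n ^ (i + 2))"
      unfolding Z_def e3 e2 by (simp add: algebra_simps)
    also have "\<dots> \<le> Y * M ^ (i + 3)" by (rule Y)
    also have "\<dots> = M ^ Suc i * (Y * (M * M))"
      unfolding M3 by (simp add: mult_ac)
    finally have "(l - C) * Z \<le> Y * (M * M)"
      using \<open>M > 0\<close> by (simp only: mult_le_cancel_left_pos zero_less_power)
    then have bound: "(l - C) * Z / (M * M) \<le> Y"
      using \<open>M > 0\<close> by (simp add: divide_le_eq)
    have "(l - C) * Z = n ^ Suc i * (n * n * l - C * (n * (n - c)) - c * (n * l))"
      unfolding Z_def by (simp add: algebra_simps)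
    moreover have "C * (n * (n - c)) \<le> C * (M * M)"
    proof (rule mult_left_mono)
      have "n * (n - c) \<le> n * n" using n assms(6) by (intro mult_left_mono) auto
      then show "n * (n - c) \<le> M * M" using nn by linarith
    qed fact
    moreover have "c * (n * l) \<le> c * (M * M)" using nl assms(6) by (rule mult_left_mono)
    moreover have "n ^ Suc i \<ge> 0" using n by simp
    ultimately have "n ^ Suc i * (n * n * l - (C + c) * (M * M)) \<le> (l - C) * Z"
      by (simp only:) (rule mult_left_mono, simp_all add: distrib_right)
    then have "n ^ Suc i * (n * n * l - (C + c) * (M * M)) / (M * M) \<le> (l - C) * Z / (M * M)"
      using \<open>M > 0\<close> by (intro divide_right_mono) auto
    moreover have "n ^ Suc i * (n * n * l - (C + c) * (M * M)) / (M * M) = n ^ (i + 3) * l / M\<^sup>2 - (C + c) * n ^ Suc i"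
      unfolding e3 power2_eq_square using \<open>M > 0\<close>
      by (simp add: right_diff_distrib diff_divide_distrib mult_ac)
    ultimately show ?thesis using bound by linarith
  qed
qed

text \<open>The two bounds are the padded one, for constructions of order \<open>M\<close> at most
  \<open>n\<close>, and the sampled one, for order at least \<open>n\<close>. The order
  \<open>M\<close> is \<open>2^(2m)\<close> for \<open>j = 0\<close> and \<open>2^(2m-1)\<close> for
  \<open>j = 1\<close>.\<close>

lemma ex_lower_parametric:
  fixes k :: nat
  assumes k: "k \<ge> 2"
  obtains C :: real where "C \<ge> 0"
    "\<And>n m j M l. n > 0 \<Longrightarrow> m > 0 \<Longrightarrow> j \<le> 1 \<Longrightarrow> l = 2 ^ (m - j) \<Longrightarrow> M = 2 ^ m * l \<Longrightarrow> M \<le> real n \<Longrightarrow>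
       M ^ (k - 1) * l - C * real n ^ (k - 1)
         \<le> fact (k + 1) * real (ex k n (clique k (k + 1)) (suspension k (cycle 4)))"
    "\<And>n m j M l. n > 0 \<Longrightarrow> m > 0 \<Longrightarrow> j \<le> 1 \<Longrightarrow> l = 2 ^ (m - j) \<Longrightarrow> M = 2 ^ m * l \<Longrightarrow> real n \<le> M \<Longrightarrow>
       real n ^ (k + 1) * l / M\<^sup>2 - C * real n ^ (k - 1)
         \<le> fact (k + 1) * real (ex k n (clique k (k + 1)) (suspension k (cycle 4)))"
proof -
  obtain C0 :: real where C0: "C0 \<ge> 0"
    "\<And>m j. m > 0 \<Longrightarrow> j \<le> 1 \<Longrightarrow> \<exists>(V :: nat set) E. finite V \<and> card V = 2 ^ m * 2 ^ (m - j) \<and>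
      (\<forall>e \<in> E. e \<subseteq> V \<and> card e = k) \<and> \<not> suspended_C4 k E \<and>
      real (card V) ^ (k - 1) * 2 ^ (m - j) - C0 * real (card V) ^ (k - 1)
        \<le> fact (k + 1) * real (card (full_sets k V E))"
    using dense_suspended_C4_free[OF k] by blast
  define c where "c = real (k * Suc k)"
  define x where "x = (\<lambda>n. ex k n (clique k (k + 1)) (suspension k (cycle 4)))"
  obtain i where i: "k = i + 2" using k by (metis add.commute le_Suc_ex)
  have c: "c \<ge> 0" by (simp add: c_def)
  show thesis
  proof (rule that)
    show "C0 + c \<ge> 0" using C0(1) c by simp
  next
    fix n m j :: nat and M l :: real
    assume n: "n > 0" and mj: "m > 0" "j \<le> 1" and l: "l = 2 ^ (m - j)" and M: "M = 2 ^ m * l" and "M \<le> real n"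
    obtain V :: "nat set" and E where V: "finite V" "card V = 2 ^ m * 2 ^ (m - j)"
      "\<And>e. e \<in> E \<Longrightarrow> e \<subseteq> V \<and> card e = k" "\<not> suspended_C4 k E"
      and bd: "real (card V) ^ (k - 1) * 2 ^ (m - j) - C0 * real (card V) ^ (k - 1)
        \<le> fact (k + 1) * real (card (full_sets k V E))"
      using C0(2)[OF mj] by blast
    have cV: "real (card V) = M" by (simp add: V(2) M l)
    then have "card V \<le> n" using \<open>M \<le> real n\<close> by simp
    have "M ^ (k - 1) * l - C0 * M ^ (k - 1) \<le> fact (k + 1) * real (card (full_sets k V E))"
      using bd unfolding cV l .
    also have "\<dots> \<le> fact (k + 1) * real (x n)"
      unfolding x_def using ex_ge_superset[OF k V(1) \<open>card V \<le> n\<close> V(3,4)]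
      by (intro mult_left_mono of_nat_mono) auto
    finally have *: "M ^ (k - 1) * l - C0 * M ^ (k - 1) \<le> fact (k + 1) * real (x n)" .
    have "C0 * M ^ (k - 1) \<le> (C0 + c) * real n ^ (k - 1)"
      using C0(1) c \<open>M \<le> real n\<close> by (intro mult_mono power_mono) (auto simp: M l)
    with * show "M ^ (k - 1) * l - (C0 + c) * real n ^ (k - 1)
         \<le> fact (k + 1) * real (ex k n (clique k (k + 1)) (suspension k (cycle 4)))"
      unfolding x_def by linarith
  next
    fix n m j :: nat and M l :: real
    assume n: "n > 0" and mj: "m > 0" "j \<le> 1" and l: "l = 2 ^ (m - j)" and M: "M = 2 ^ m * l" and "real n \<le> M"
    obtain V :: "nat set" and E where V: "finite V" "card V = 2 ^ m * 2 ^ (m - j)"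
      "\<And>e. e \<in> E \<Longrightarrow> e \<subseteq> V \<and> card e = k" "\<not> suspended_C4 k E"
      and bd: "real (card V) ^ (k - 1) * 2 ^ (m - j) - C0 * real (card V) ^ (k - 1)
        \<le> fact (k + 1) * real (card (full_sets k V E))"
      using C0(2)[OF mj] by blast
    have cV: "real (card V) = M" by (simp add: V(2) M l)
    then have "n \<le> card V" using \<open>real n \<le> M\<close> by simp
    define F where "F = fact (k + 1) * real (card (full_sets k V E))"
    have F: "M ^ (k - 1) * l - C0 * M ^ (k - 1) \<le> F"
      using bd unfolding cV l F_def .
    have "F * (real n ^ (k + 1) - c * real n ^ k) \<le> F * (fact (k + 1) * real (n choose (k + 1)))"
      using fact_choose_lower[of n k] unfolding c_def F_def
      by (intro mult_left_mono) (simp_all del: fact_Suc power_Suc of_nat_mult)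
    also have "\<dots> = fact (k + 1) * fact (k + 1) * real (card (full_sets k V E) * (n choose (k + 1)))"
      by (simp add: F_def del: fact_Suc)
    also have "\<dots> \<le> fact (k + 1) * fact (k + 1) * real (x n * (card V choose (k + 1)))"
      unfolding x_def using ex_ge_subset[OF k V(1) \<open>n \<le> card V\<close> V(3,4)]
      by (intro mult_left_mono of_nat_mono) auto
    also have "\<dots> = fact (k + 1) * real (x n) * real ((card V choose (k + 1)) * fact (k + 1))"
      by (simp del: fact_Suc)
    also have "\<dots> \<le> fact (k + 1) * real (x n) * real (card V ^ (k + 1))"
      by (intro mult_left_mono of_nat_mono binomial_fact_pow) auto
    also have "\<dots> = fact (k + 1) * real (x n) * M ^ (k + 1)"
      by (simp only: of_nat_power cV)
    finally have Y: "F * (real n ^ (k + 1) - c * real n ^ k) \<le> fact (k + 1) * real (x n) * M ^ (k + 1)" .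
    have ki: "k + 1 = i + 3" "k = i + 2" "k - 1 = Suc i" using i by simp_all
    have pos: "0 \<le> l" "l \<le> M" using l by (simp_all add: M)
    have "real n ^ (i + 3) * l / M\<^sup>2 - (C0 + c) * real n ^ Suc i \<le> fact (k + 1) * real (x n)"
    proof (rule scaled_count_bound[OF _ \<open>real n \<le> M\<close> pos C0(1) c])
      show "M ^ Suc i * l - C0 * M ^ Suc i \<le> F" using F unfolding ki(3) .
      show "F * (real n ^ (i + 3) - c * real n ^ (i + 2)) \<le> fact (k + 1) * real (x n) * M ^ (i + 3)"
        using Y unfolding ki(1) ki(2)[symmetric] .
    qed (use n in \<open>auto simp: F_def\<close>)
    then show "real n ^ (k + 1) * l / M\<^sup>2 - (C0 + c) * real n ^ (k - 1)
         \<le> fact (k + 1) * real (ex k n (clique k (k + 1)) (suspension k (cycle 4)))"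
      by (simp only: ki(1,3) x_def)
  qed
qed

section \<open>Choosing the construction for each order\<close>

lemma powr_realpow_real: "b > 0 \<Longrightarrow> (b powr y) ^ m = b powr (real m * y)" for b :: real
  by (simp add: powr_powr mult.commute flip: powr_realpow)

text \<open>Let \<open>n = 2^(2p+z)\<close> and \<open>t = 1/(k+1)\<close>. Padding from order
  \<open>2^(2p)\<close> and sampling from \<open>2^(2p+1)\<close> give the same leading count at
  \<open>z = 2t\<close>, where both lose \<open>2^((k-1/2) 2t) = 2^(2-3t)\<close>; this is the
  constant in the bound. Between \<open>2^(2p+1)\<close> and \<open>2^(2p+2)\<close> the crossing is
  at \<open>z = 1 + t\<close>.\<close>

lemma ex_lower:
  fixes k :: nat
  assumes k: "k \<ge> 2"
  obtains C :: real where "C \<ge> 0"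
    "\<And>n. n \<ge> 1 \<Longrightarrow> real n powr (real k - 1/2) / 2 powr (2 - 3 / (real k + 1)) - C * real n ^ (k - 1)
       \<le> fact (k + 1) * real (ex k n (clique k (k + 1)) (suspension k (cycle 4)))"
proof -
  obtain C1 :: real where C1: "C1 \<ge> 0"
    "\<And>n m j M l. n > 0 \<Longrightarrow> m > 0 \<Longrightarrow> j \<le> 1 \<Longrightarrow> l = 2 ^ (m - j) \<Longrightarrow> M = 2 ^ m * l \<Longrightarrow> M \<le> real n \<Longrightarrow>
       M ^ (k - 1) * l - C1 * real n ^ (k - 1)
         \<le> fact (k + 1) * real (ex k n (clique k (k + 1)) (suspension k (cycle 4)))"
    "\<And>n m j M l. n > 0 \<Longrightarrow> m > 0 \<Longrightarrow> j \<le> 1 \<Longrightarrow> l = 2 ^ (m - j) \<Longrightarrow> M = 2 ^ m * l \<Longrightarrow> real n \<le> M \<Longrightarrow>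
       real n ^ (k + 1) * l / M\<^sup>2 - C1 * real n ^ (k - 1)
         \<le> fact (k + 1) * real (ex k n (clique k (k + 1)) (suspension k (cycle 4)))"
    using ex_lower_parametric[OF k] by blast
  define x where "x = (\<lambda>n. fact (k + 1) * real (ex k n (clique k (k + 1)) (suspension k (cycle 4))))"
  define t where "t = 1 / (real k + 1)"
  have t: "0 < t" "t \<le> 1 / 3" "real k * t = 1 - t"
    using k by (simp_all add: t_def field_simps)
  have "real n powr (real k - 1/2) / 2 powr (2 - 3 / (real k + 1)) - (C1 + 2) * real n ^ (k - 1) \<le> x n"
    if "n \<ge> 1" for n
  proof -
    define y where "y = log 2 n"
    have n: "real n = 2 powr y" using \<open>n \<ge> 1\<close> by (simp add: y_def)
    have "y \<ge> 0" using \<open>n \<ge> 1\<close> by (simp add: y_def)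
    define p where "p = nat \<lfloor>y / 2\<rfloor>"
    have p: "2 * real p \<le> y" "y < 2 * real p + 2"
      using \<open>y \<ge> 0\<close> unfolding p_def by linarith+
    define z where "z = y - 2 * real p"
    have z: "0 \<le> z" "z < 2" "y = 2 * real p + z" using p by (simp_all add: z_def)
    define T where "T = (real k - 1 / 2) * y - (2 - 3 * t)"
    have target: "real n powr (real k - 1/2) / 2 powr (2 - 3 / (real k + 1)) = 2 powr T"
    proof -
      have "2 - 3 / (real k + 1) = 2 - 3 * t" by (simp add: t_def)
      then show ?thesis
        unfolding n T_def powr_powr powr_diff[of 2 "(real k - 1 / 2) * y"] by (simp only: mult.commute)
    qed
    have kk: "real (k - 1) = real k - 1" using k by simp
    have finish: "2 powr T - (C1 + 2) * real n ^ (k - 1) \<le> x n"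
      if "2 powr w - C1 * real n ^ (k - 1) \<le> x n" "T \<le> w" for w
    proof -
      have "2 powr T \<le> 2 powr w" using that(2) by (intro powr_mono) auto
      moreover have "C1 * real n ^ (k - 1) \<le> (C1 + 2) * real n ^ (k - 1)"
        by (intro mult_right_mono) auto
      ultimately show ?thesis using that(1) by linarith
    qed
    have pw: "(2 :: real) ^ q = 2 powr real q" for q by (simp add: powr_realpow)
    \<comment> \<open>The vertex counts \<open>2 powr (2 * p + i)\<close> used are \<open>i = 0\<close> (padded), \<open>i = 1\<close> (sampled),
      \<open>i = 1\<close> (padded) and \<open>i = 2\<close> (sampled); the extreme case is \<open>z = 2 * t\<close>.\<close>
    consider "p = 0" | "p > 0" "z \<le> 2 * t" | "p > 0" "2 * t \<le> z" "z \<le> 1" | "p > 0" "1 \<le> z" "z \<le> 1 + t"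
      | "p > 0" "1 + t \<le> z"
      by linarith
    then have "2 powr T - (C1 + 2) * real n ^ (k - 1) \<le> x n"
    proof cases
      \<comment> \<open>For \<open>n < 4\<close> no construction is used: the main term is at most
        \<open>2 * real n ^ (k - 1)\<close>, which accounts for the 2 in
        \<open>C1 + 2\<close>.\<close>
      case 1
      have "T \<le> y * real (k - 1) + 1"
      proof -
        have "T = y * real (k - 1) + y / 2 - (2 - 3 * t)"
          unfolding T_def kk by (simp add: algebra_simps)
        then show ?thesis using z 1 t by simp
      qed
      then have "2 powr T \<le> 2 powr (y * real (k - 1) + 1)" by (intro powr_mono) auto
      also have "\<dots> = 2 * real n ^ (k - 1)"
        unfolding n powr_realpow_real[OF zero_less_numeral] by (simp add: powr_add mult.commute)
      also have "\<dots> \<le> (C1 + 2) * real n ^ (k - 1)"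
        using C1(1) by (intro mult_right_mono) auto
      finally have "2 powr T - (C1 + 2) * real n ^ (k - 1) \<le> 0" by simp
      also have "0 \<le> x n" by (simp add: x_def)
      finally show ?thesis .
    next
      case 2
      define l M :: real where "l = 2 ^ (p - 0)" and "M = 2 ^ p * l"
      have lM: "l = 2 powr p" "M = 2 powr (2 * p)"
        by (simp_all add: l_def M_def pw flip: powr_add)
      have "M ^ (k - 1) * l - C1 * real n ^ (k - 1) \<le> x n"
        unfolding x_def
        by (rule C1(2)[OF _ _ _ l_def M_def]) (use \<open>n \<ge> 1\<close> 2 p(1) in \<open>auto simp: lM n intro!: powr_mono\<close>)
      moreover have "M ^ (k - 1) * l = 2 powr (real (k - 1) * (2 * real p) + p)"
        unfolding lM powr_realpow_real[OF zero_less_numeral] by (simp add: powr_add)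
      ultimately have "2 powr (real (k - 1) * (2 * real p) + p) - C1 * real n ^ (k - 1) \<le> x n" by simp
      moreover have "T \<le> real (k - 1) * (2 * real p) + p"
      proof -
        have "(real k - 1 / 2) * z \<le> (real k - 1 / 2) * (2 * t)"
          using 2 k by (intro mult_left_mono) auto
        then show ?thesis
          using t(3) unfolding T_def kk z(3) by (simp add: algebra_simps)
      qed
      ultimately show ?thesis by (rule finish)
    next
      case 3
      define l M :: real where "l = 2 ^ (p + 1 - 1)" and "M = 2 ^ (p + 1) * l"
      have lM: "l = 2 powr p" "M = 2 powr (2 * p + 1)"
        by (simp_all only: l_def M_def pw flip: powr_add) (simp_all add: algebra_simps)
      have "real n ^ (k + 1) * l / M\<^sup>2 - C1 * real n ^ (k - 1) \<le> x n"
        unfolding x_def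
        by (rule C1(3)[OF _ _ _ l_def M_def]) (use \<open>n \<ge> 1\<close> 3 z in \<open>auto simp: lM n intro!: powr_mono\<close>)
      moreover have "real n ^ (k + 1) * l / M\<^sup>2 = 2 powr (real (k + 1) * y + p - 2 * (2 * p + 1))"
        unfolding n lM powr_realpow_real[OF zero_less_numeral]
        by (simp only: powr_add powr_diff[of 2 "_ + _"] of_nat_mult)
      ultimately have "2 powr (real (k + 1) * y + p - 2 * (2 * p + 1)) - C1 * real n ^ (k - 1) \<le> x n" by simp
      moreover have "T \<le> real (k + 1) * y + p - 2 * (2 * p + 1)"
        using 3 unfolding T_def z(3) by (simp add: algebra_simps)
      ultimately show ?thesis by (rule finish)
    next
      case 4
      define l M :: real where "l = 2 ^ (p + 1 - 1)" and "M = 2 ^ (p + 1) * l"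
      have lM: "l = 2 powr p" "M = 2 powr (2 * p + 1)"
        by (simp_all only: l_def M_def pw flip: powr_add) (simp_all add: algebra_simps)
      have "M ^ (k - 1) * l - C1 * real n ^ (k - 1) \<le> x n"
        unfolding x_def
        by (rule C1(2)[OF _ _ _ l_def M_def]) (use \<open>n \<ge> 1\<close> 4 z in \<open>auto simp: lM n intro!: powr_mono\<close>)
      moreover have "M ^ (k - 1) * l = 2 powr (real (k - 1) * (2 * p + 1) + p)"
        unfolding lM powr_realpow_real[OF zero_less_numeral] by (simp add: powr_add)
      ultimately have "2 powr (real (k - 1) * (2 * p + 1) + p) - C1 * real n ^ (k - 1) \<le> x n" by simp
      moreover have "T \<le> real (k - 1) * (2 * p + 1) + p"
      proof -
        define a b u v where "a = (real k - 1 / 2) * z" and "b = (real k - 1 / 2) * (1 + t)"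
          and "u = (real k - 1 / 2) * (2 * real p)" and "v = (real k - 1) * real (2 * p + 1) + p"
        \<comment> \<open>At the end point \<open>z = 1 + t\<close> the slack is
          \<open>1/2 - 3t/2\<close>, nonnegative because \<open>k \<ge> 2\<close> gives
          \<open>t \<le> 1/3\<close>.\<close>
        have "a \<le> b"
          unfolding a_def b_def using 4 k by (intro mult_left_mono) auto
        moreover have "b = real k + real k * t - 1 / 2 - t / 2"
          unfolding b_def by (simp add: algebra_simps add_divide_distrib)
        moreover have "v = u + real k - 1"
          unfolding v_def u_def by (simp add: algebra_simps)
        moreover have "T = u + a - (2 - 3 * t)"
          unfolding T_def z(3) u_def a_def by (simp only: distrib_left)
        ultimately have "T \<le> v" using t(2,3) by linarith
        then show ?thesis unfolding kk v_def .
      qed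
      ultimately show ?thesis by (rule finish)
    next
      case 5
      define l M :: real where "l = 2 ^ (p + 1 - 0)" and "M = 2 ^ (p + 1) * l"
      have lM: "l = 2 powr (p + 1)" "M = 2 powr (2 * p + 2)"
        by (simp_all only: l_def M_def pw flip: powr_add) (simp_all add: algebra_simps)
      have "real n ^ (k + 1) * l / M\<^sup>2 - C1 * real n ^ (k - 1) \<le> x n"
        unfolding x_def
        by (rule C1(3)[OF _ _ _ l_def M_def]) (use \<open>n \<ge> 1\<close> 5 z in \<open>auto simp: lM n intro!: powr_mono\<close>)
      moreover have "real n ^ (k + 1) * l / M\<^sup>2 = 2 powr (real (k + 1) * y + (p + 1) - 2 * (2 * p + 2))"
        unfolding n lM powr_realpow_real[OF zero_less_numeral]
        by (simp only: powr_add powr_diff[of 2 "_ + _"] of_nat_mult)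
      ultimately have "2 powr (real (k + 1) * y + (p + 1) - 2 * (2 * p + 2)) - C1 * real n ^ (k - 1) \<le> x n" by simp
      moreover have "T \<le> real (k + 1) * y + (p + 1) - 2 * (2 * p + 2)"
        using 5 t unfolding T_def z(3) by (simp add: algebra_simps)
      ultimately show ?thesis by (rule finish)
    qed
    then show ?thesis unfolding target .
  qed
  then show thesis
    using C1(1) unfolding x_def by (intro that[of "C1 + 2"]) auto
qed

theorem corollary2:
  fixes k :: nat
  assumes "k \<ge> 2"
  shows "\<exists>f g :: nat \<Rightarrow> real.
           f \<in> O(\<lambda>n. real n ^ (k - 1)) \<and> g \<in> O(\<lambda>n. real n ^ (k - 1)) \<and>
           (\<forall>n\<ge>1.
              real n powr (real k - 1/2) / (2 powr (2 - 3 / (real k + 1)) * fact (k + 1)) - f n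
                \<le> real (ex k n (clique k (k + 1)) (suspension k (cycle 4))) \<and>
              real (ex k n (clique k (k + 1)) (suspension k (cycle 4)))
                \<le> real n powr (real k - 1/2) / fact (k + 1) + g n)"
proof -
  define x where "x = (\<lambda>n. real (ex k n (clique k (k + 1)) (suspension k (cycle 4))))"
  define F :: real where "F = fact (k + 1)"
  have F: "F > 0" by (simp add: F_def del: fact_Suc)
  obtain C :: real where C: "\<And>n. n \<ge> 1 \<Longrightarrow>
      real n powr (real k - 1/2) / 2 powr (2 - 3 / (real k + 1)) - C * real n ^ (k - 1) \<le> F * x n"
    using ex_lower[OF assms] unfolding x_def F_def by metis
  have lower: "real n powr (real k - 1/2) / (2 powr (2 - 3 / (real k + 1)) * F) - C / F * real n ^ (k - 1) \<le> x n"
    if "n \<ge> 1" for n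
    using C[OF that] F by (simp add: field_simps)
  have upper: "x n \<le> real n powr (real k - 1/2) / F + 1 / F * real n ^ (k - 1)" if "n \<ge> 1" for n
  proof -
    have "real n ^ (k - 1) * sqrt n = real n powr (real (k - 1)) * real n powr (1 / 2)"
      using that by (simp add: powr_realpow powr_half_sqrt)
    also have "\<dots> = real n powr (real k - 1/2)"
      using assms by (simp add: powr_add[symmetric] of_nat_diff)
    finally have "F * x n \<le> real n powr (real k - 1/2) + real n ^ (k - 1)"
      using ex_upper[OF assms, of n] unfolding x_def F_def by simp
    then have "x n \<le> (real n powr (real k - 1/2) + real n ^ (k - 1)) / F"
      using F by (simp add: field_simps)
    then show ?thesis by (simp add: add_divide_distrib)
  qed
  show ?thesis
    using lower upper unfolding x_def F_def
    by (intro exI[of _ "\<lambda>n. C / fact (k + 1) * real n ^ (k - 1)"] exI[of _ "\<lambda>n. 1 / fact (k + 1) * real n ^ (k - 1)"])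
      (simp del: fact_Suc)
qed

end
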